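(* Let $(X,d,\mu,\mathcal{E},\mathcal{F})$ be an Ahlfors $d_H$-regular strongly local regular symmetric Dirichlet space that satisfies sub-Gaussian heat kernel estimates with walk dimension $d_W$ and the weak Bakry–Émery condition $BE(\kappa)$ with $0<\kappa\le\frac{d_W}2$. Then, for any $p\ge2$, there exists a constant $C>0$ such that for every $t>0$ and $f\in L^p(X,\mu)$, \[ \|P_tf\|_{p,\left(1-\frac2p\right)\frac{\kappa}{d_W}+\frac1p}\le\frac{C}{t^{\left(1-\frac2p\right)\frac{\kappa}{d_W}+\frac1p}}\,\|f\|_{L^p(X,\mu)}. \] In particular, for $t>0$, $P_t:L^p(X,\mu)\to\mathbf{B}^{p,\left(1-\frac2p\right)\frac{\kappa}{d_W}+\frac1p}(X)$ is bounded.
   Context: $(X,d,\mu)$ is a metric measure space whose balls $B(x,r)=\{y:d(x,y)<r\}$ have compact closure; $\mathcal{E}$ is a strongly local regular symmetric Dirichlet form on $L^2(X,\mu)$ with domain $\mathcal{F}$ and conservative semigroup $P_t$ ($P_t1=1$), extended to all $L^p(X,\mu)$. Ahlfors $d_H$-regular: there are $c_1,c_2,d_H\in(0,\infty)$ with $c_1r^{d_H}\le\mu(B(x,r))\le c_2r^{d_H}$ for all $x\in X$, $r\in(0,\infty)$. Sub-Gaussian heat kernel estimates: $P_t$ has a measurable heat kernel $p_t(x,y)$ and for some $c_3,c_4,c_5,c_6\in(0,\infty)$, $d_W\in[2,\infty)$, \[ c_5t^{-d_H/d_W}\exp\left(-c_6\left(\tfrac{d(x,y)^{d_W}}t\right)^{\frac1{d_W-1}}\right)\le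 p_t(x,y)\le c_3t^{-d_H/d_W}\exp\left(-c_4\left(\tfrac{d(x,y)^{d_W}}t\right)^{\frac1{d_W-1}}\right) \] for $\mu\times\mu$-a.e. $(x,y)$ and each $t\in(0,\infty)$. $BE(\kappa)$: there is $C>0$ such that for all $t>0$, $g\in L^\infty(X,\mu)$, $x,y\in X$, \[ |P_tg(x)-P_tg(y)|\le C\,\frac{d(x,y)^\kappa}{t^{\kappa/d_W}}\,\|g\|_{L^\infty(X,\mu)}. \] For $p\ge1$, $\alpha\ge0$: $\|f\|_{p,\alpha}=\sup_{t>0}t^{-\alpha}\left(\int_X\int_X|f(x)-f(y)|^pp_t(x,y)\,d\mu(x)\,d\mu(y)\right)^{1/p}$, and $\mathbf{B}^{p,\alpha}(X)=\{f\in L^p(X,\mu):\|f\|_{p,\alpha}<\infty\}$ with norm $\|f\|_{L^p(X,\mu)}+\|f\|_{p,\alpha}$. *)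

theory Defs
  imports "HOL-Probability.Probability"
begin

text \<open>
  Elements of \<open>L\<^sup>p\<close> are represented by measurable functions; everything below is stable under
  almost everywhere equality, and operators are linear up to almost everywhere equality.
\<close>

definition Lp_space :: "'a measure \<Rightarrow> real \<Rightarrow> ('a \<Rightarrow> real) set" where
  "Lp_space \<mu> p = {f \<in> borel_measurable \<mu>. integrable \<mu> (\<lambda>x. \<bar>f x\<bar> powr p)}"

definition Lp_norm :: "'a measure \<Rightarrow> real \<Rightarrow> ('a \<Rightarrow> real) \<Rightarrow> real" where
  "Lp_norm \<mu> p f = (\<integral>x. \<bar>f x\<bar> powr p \<partial>\<mu>) powr (1 / p)"

definition Linf_space :: "'a measure \<Rightarrow> ('a \<Rightarrow> real) set" where
  "Linf_space \<mu> = {f \<in> borel_measurable \<mu>. \<exists>K. AE x in \<mu>. \<bar>f x\<bar> \<le> K}"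

definition Linf_norm :: "'a measure \<Rightarrow> ('a \<Rightarrow> real) \<Rightarrow> real" where
  "Linf_norm \<mu> f = real_of_ereal (esssup \<mu> (\<lambda>x. ereal \<bar>f x\<bar>))"

definition L2_inner :: "'a measure \<Rightarrow> ('a \<Rightarrow> real) \<Rightarrow> ('a \<Rightarrow> real) \<Rightarrow> real" where
  "L2_inner \<mu> f g = (\<integral>x. f x * g x \<partial>\<mu>)"

definition linear_AE ::
  "'a measure \<Rightarrow> ('a \<Rightarrow> real) set \<Rightarrow> (('a \<Rightarrow> real) \<Rightarrow> ('a \<Rightarrow> real)) \<Rightarrow> bool" where
  "linear_AE \<mu> V T \<longleftrightarrow>
     (\<forall>f\<in>V. \<forall>g\<in>V. \<forall>a b. AE x in \<mu>. T (\<lambda>y. a * f y + b * g y) x = a * T f x + b * T g x)"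

definition bounded_operator ::
  "'a measure \<Rightarrow> ('a \<Rightarrow> real) set \<Rightarrow> (('a \<Rightarrow> real) \<Rightarrow> real) \<Rightarrow>
   ('a \<Rightarrow> real) set \<Rightarrow> (('a \<Rightarrow> real) \<Rightarrow> real) \<Rightarrow> (('a \<Rightarrow> real) \<Rightarrow> ('a \<Rightarrow> real)) \<Rightarrow> bool" where
  "bounded_operator \<mu> V nV W nW T \<longleftrightarrow>
     (\<forall>f\<in>V. T f \<in> W) \<and> linear_AE \<mu> V T \<and> (\<exists>K. \<forall>f\<in>V. nW (T f) \<le> K * nV f)"

definition contraction_operator ::
  "'a measure \<Rightarrow> ('a \<Rightarrow> real) set \<Rightarrow> (('a \<Rightarrow> real) \<Rightarrow> real) \<Rightarrow>
   (('a \<Rightarrow> real) \<Rightarrow> ('a \<Rightarrow> real)) \<Rightarrow> bool" where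
  "contraction_operator \<mu> V nV T \<longleftrightarrow>
     (\<forall>f\<in>V. T f \<in> V) \<and> linear_AE \<mu> V T \<and> (\<forall>f\<in>V. nV (T f) \<le> nV f)"

definition metric_measure_space :: "'a::metric_space measure \<Rightarrow> bool" where
  "metric_measure_space \<mu> \<longleftrightarrow>
     sets \<mu> = sets borel \<and> (\<forall>x r. compact (closure (ball (x::'a) r)))"

definition Ahlfors_regular :: "'a::metric_space measure \<Rightarrow> real \<Rightarrow> bool" where
  "Ahlfors_regular \<mu> d\<^sub>H \<longleftrightarrow> 0 < d\<^sub>H \<and>
     (\<exists>c1>0. \<exists>c2>0. \<forall>x. \<forall>r>0.
        ennreal (c1 * r powr d\<^sub>H) \<le> emeasure \<mu> (ball x r) \<and>
        emeasure \<mu> (ball x r) \<le> ennreal (c2 * r powr d\<^sub>H))"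

definition E1_form ::
  "'a measure \<Rightarrow> (('a \<Rightarrow> real) \<Rightarrow> ('a \<Rightarrow> real) \<Rightarrow> real) \<Rightarrow> ('a \<Rightarrow> real) \<Rightarrow> real" where
  "E1_form \<mu> E f = E f f + L2_inner \<mu> f f"

text \<open>
  A densely defined, closed, nonnegative symmetric bilinear form on \<open>L\<^sup>2\<close> on which the unit
  contraction operates. The values of \<open>E\<close> outside \<open>F \<times> F\<close> are irrelevant.
\<close>

definition dirichlet_form ::
  "'a measure \<Rightarrow> (('a \<Rightarrow> real) \<Rightarrow> ('a \<Rightarrow> real) \<Rightarrow> real) \<Rightarrow> ('a \<Rightarrow> real) set \<Rightarrow> bool" where
  "dirichlet_form \<mu> E F \<longleftrightarrow>
     F \<subseteq> Lp_space \<mu> 2 \<and>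
     (\<forall>f\<in>F. \<forall>g\<in>borel_measurable \<mu>. (AE x in \<mu>. f x = g x) \<longrightarrow>
        g \<in> F \<and> (\<forall>h\<in>F. E g h = E f h)) \<and>
     (\<forall>f\<in>F. \<forall>g\<in>F. \<forall>a b. (\<lambda>x. a * f x + b * g x) \<in> F \<and>
        (\<forall>h\<in>F. E (\<lambda>x. a * f x + b * g x) h = a * E f h + b * E g h)) \<and>
     (\<forall>f\<in>F. \<forall>g\<in>F. E f g = E g f) \<and>
     (\<forall>f\<in>F. 0 \<le> E f f) \<and>
     (\<forall>f\<in>Lp_space \<mu> 2. \<forall>\<epsilon>>0. \<exists>g\<in>F. Lp_norm \<mu> 2 (\<lambda>x. f x - g x) < \<epsilon>) \<and>
     (\<forall>u. (\<forall>n::nat. u n \<in> F) \<and>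
          (\<forall>\<epsilon>>0. \<exists>N. \<forall>m\<ge>N. \<forall>n\<ge>N. E1_form \<mu> E (\<lambda>x. u m x - u n x) < \<epsilon>) \<longrightarrow>
          (\<exists>v\<in>F. (\<lambda>n. E1_form \<mu> E (\<lambda>x. u n x - v x)) \<longlonglongrightarrow> 0)) \<and>
     (\<forall>f\<in>F. (\<lambda>x. min 1 (max 0 (f x))) \<in> F \<and>
        E (\<lambda>x. min 1 (max 0 (f x))) (\<lambda>x. min 1 (max 0 (f x))) \<le> E f f)"

definition compactly_supported_continuous :: "('a::topological_space \<Rightarrow> real) set" where
  "compactly_supported_continuous =
     {f. continuous_on UNIV f \<and> compact (closure {x. f x \<noteq> 0})}"

definition regular_form ::
  "'a::metric_space measure \<Rightarrow> (('a \<Rightarrow> real) \<Rightarrow> ('a \<Rightarrow> real) \<Rightarrow> real) \<Rightarrow> ('a \<Rightarrow> real) set \<Rightarrow> bool" where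
  "regular_form \<mu> E F \<longleftrightarrow>
     (\<forall>f\<in>F. \<forall>\<epsilon>>0. \<exists>g\<in>F \<inter> compactly_supported_continuous.
        E1_form \<mu> E (\<lambda>x. f x - g x) < \<epsilon>) \<and>
     (\<forall>f\<in>compactly_supported_continuous. \<forall>\<epsilon>>0. \<exists>g\<in>F \<inter> compactly_supported_continuous.
        \<forall>x. \<bar>f x - g x\<bar> \<le> \<epsilon>)"

text \<open>The support of the signed measure \<open>u \<cdot> \<mu>\<close>, invariant under almost everywhere equality.\<close>

definition ess_support :: "'a::topological_space measure \<Rightarrow> ('a \<Rightarrow> real) \<Rightarrow> 'a set" where
  "ess_support \<mu> u = - \<Union>{U. open U \<and> (AE x in \<mu>. x \<in> U \<longrightarrow> u x = 0)}"

definition strongly_local_form ::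
  "'a::metric_space measure \<Rightarrow> (('a \<Rightarrow> real) \<Rightarrow> ('a \<Rightarrow> real) \<Rightarrow> real) \<Rightarrow> ('a \<Rightarrow> real) set \<Rightarrow> bool" where
  "strongly_local_form \<mu> E F \<longleftrightarrow>
     (\<forall>u\<in>F. \<forall>v\<in>F. compact (ess_support \<mu> u) \<and> compact (ess_support \<mu> v) \<and>
        (\<exists>U c. open U \<and> ess_support \<mu> u \<subseteq> U \<and> (AE x in \<mu>. x \<in> U \<longrightarrow> v x = c)) \<longrightarrow>
        E u v = 0)"

text \<open>
  The graph of the nonpositive self-adjoint operator \<open>L\<close> on \<open>L\<^sup>2\<close> determined by
  \<open>E(f,v) = -\<langle>L f, v\<rangle>\<close>, and the graph of the infinitesimal generator of a semigroup.
\<close>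

definition form_operator ::
  "'a measure \<Rightarrow> (('a \<Rightarrow> real) \<Rightarrow> ('a \<Rightarrow> real) \<Rightarrow> real) \<Rightarrow> ('a \<Rightarrow> real) set \<Rightarrow>
   (('a \<Rightarrow> real) \<times> ('a \<Rightarrow> real)) set" where
  "form_operator \<mu> E F =
     {(f, h). f \<in> F \<and> h \<in> Lp_space \<mu> 2 \<and> (\<forall>v\<in>F. E f v = - L2_inner \<mu> h v)}"

definition semigroup_generator ::
  "'a measure \<Rightarrow> (real \<Rightarrow> ('a \<Rightarrow> real) \<Rightarrow> ('a \<Rightarrow> real)) \<Rightarrow>
   (('a \<Rightarrow> real) \<times> ('a \<Rightarrow> real)) set" where
  "semigroup_generator \<mu> P =
     {(f, h). f \<in> Lp_space \<mu> 2 \<and> h \<in> Lp_space \<mu> 2 \<and>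
        ((\<lambda>t. Lp_norm \<mu> 2 (\<lambda>x. (P t f x - f x) / t - h x)) \<longlongrightarrow> 0) (at_right 0)}"

definition L2_semigroup_of_form ::
  "'a measure \<Rightarrow> (('a \<Rightarrow> real) \<Rightarrow> ('a \<Rightarrow> real) \<Rightarrow> real) \<Rightarrow> ('a \<Rightarrow> real) set \<Rightarrow>
   (real \<Rightarrow> ('a \<Rightarrow> real) \<Rightarrow> ('a \<Rightarrow> real)) \<Rightarrow> bool" where
  "L2_semigroup_of_form \<mu> E F P \<longleftrightarrow>
     (\<forall>t>0. contraction_operator \<mu> (Lp_space \<mu> 2) (Lp_norm \<mu> 2) (P t)) \<and>
     (\<forall>s>0. \<forall>t>0. \<forall>f\<in>Lp_space \<mu> 2. AE x in \<mu>. P (s + t) f x = P s (P t f) x) \<and>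
     (\<forall>t>0. \<forall>f\<in>Lp_space \<mu> 2. \<forall>g\<in>Lp_space \<mu> 2. L2_inner \<mu> (P t f) g = L2_inner \<mu> f (P t g)) \<and>
     (\<forall>f\<in>Lp_space \<mu> 2. ((\<lambda>t. Lp_norm \<mu> 2 (\<lambda>x. P t f x - f x)) \<longlongrightarrow> 0) (at_right 0)) \<and>
     semigroup_generator \<mu> P = form_operator \<mu> E F"

text \<open>
  The operators \<open>P t\<close> act on all the spaces \<open>L\<^sup>p\<close> simultaneously. For \<open>p < \<infinity>\<close> the contraction on
  \<open>L\<^sup>p\<close> is determined by the one on \<open>L\<^sup>2\<close> through density of the intersection; on \<open>L\<^sup>\<infinity>\<close>, where
  density fails, it is the adjoint of the one on \<open>L\<^sup>1\<close>.
\<close>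

definition extended_to_Lp ::
  "'a measure \<Rightarrow> (real \<Rightarrow> ('a \<Rightarrow> real) \<Rightarrow> ('a \<Rightarrow> real)) \<Rightarrow> bool" where
  "extended_to_Lp \<mu> P \<longleftrightarrow>
     (\<forall>t>0. \<forall>p\<ge>1. contraction_operator \<mu> (Lp_space \<mu> p) (Lp_norm \<mu> p) (P t)) \<and>
     (\<forall>t>0. contraction_operator \<mu> (Linf_space \<mu>) (Linf_norm \<mu>) (P t)) \<and>
     (\<forall>t>0. \<forall>f\<in>Linf_space \<mu>. \<forall>g\<in>Lp_space \<mu> 1. (\<integral>x. P t f x * g x \<partial>\<mu>) = (\<integral>x. f x * P t g x \<partial>\<mu>))"

definition conservative ::
  "'a measure \<Rightarrow> (real \<Rightarrow> ('a \<Rightarrow> real) \<Rightarrow> ('a \<Rightarrow> real)) \<Rightarrow> bool" where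
  "conservative \<mu> P \<longleftrightarrow> (\<forall>t>0. AE x in \<mu>. P t (\<lambda>_. 1) x = 1)"

definition heat_kernel ::
  "'a measure \<Rightarrow> (real \<Rightarrow> ('a \<Rightarrow> real) \<Rightarrow> ('a \<Rightarrow> real)) \<Rightarrow> (real \<Rightarrow> 'a \<Rightarrow> 'a \<Rightarrow> real) \<Rightarrow> bool" where
  "heat_kernel \<mu> P pt \<longleftrightarrow>
     (\<forall>t>0. (\<lambda>(x, y). pt t x y) \<in> borel_measurable (\<mu> \<Otimes>\<^sub>M \<mu>) \<and>
        (\<forall>f\<in>Lp_space \<mu> 2. AE x in \<mu>.
           integrable \<mu> (\<lambda>y. pt t x y * f y) \<and> P t f x = (\<integral>y. pt t x y * f y \<partial>\<mu>)))"

definition sub_Gaussian ::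
  "'a::metric_space measure \<Rightarrow> (real \<Rightarrow> 'a \<Rightarrow> 'a \<Rightarrow> real) \<Rightarrow> real \<Rightarrow> real \<Rightarrow> bool" where
  "sub_Gaussian \<mu> pt d\<^sub>H d\<^sub>W \<longleftrightarrow> 2 \<le> d\<^sub>W \<and>
     (\<exists>c3>0. \<exists>c4>0. \<exists>c5>0. \<exists>c6>0. \<forall>t>0. AE (x, y) in \<mu> \<Otimes>\<^sub>M \<mu>.
        c5 * t powr (- d\<^sub>H / d\<^sub>W) * exp (- c6 * (dist x y powr d\<^sub>W / t) powr (1 / (d\<^sub>W - 1))) \<le> pt t x y \<and>
        pt t x y \<le> c3 * t powr (- d\<^sub>H / d\<^sub>W) * exp (- c4 * (dist x y powr d\<^sub>W / t) powr (1 / (d\<^sub>W - 1))))"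

text \<open>
  The weak Bakry-Emery estimate concerns all points \<open>x\<close>, \<open>y\<close>, whereas \<open>P t g\<close> is only determined
  almost everywhere: it is the estimate for the (continuous) version \<open>h\<close> of \<open>P t g\<close>.
\<close>

definition weak_Bakry_Emery ::
  "'a::metric_space measure \<Rightarrow> (real \<Rightarrow> ('a \<Rightarrow> real) \<Rightarrow> ('a \<Rightarrow> real)) \<Rightarrow> real \<Rightarrow> real \<Rightarrow> bool" where
  "weak_Bakry_Emery \<mu> P d\<^sub>W \<kappa> \<longleftrightarrow>
     (\<exists>C>0. \<forall>t>0. \<forall>g\<in>Linf_space \<mu>. \<exists>h. (AE x in \<mu>. P t g x = h x) \<and>
        (\<forall>x y. \<bar>h x - h y\<bar> \<le> C * (dist x y powr \<kappa> / t powr (\<kappa> / d\<^sub>W)) * Linf_norm \<mu> g))"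

definition ennreal_powr :: "ennreal \<Rightarrow> real \<Rightarrow> ennreal" where
  "ennreal_powr a q = (if a = \<top> then \<top> else ennreal (enn2real a powr q))"

definition besov_seminorm ::
  "'a measure \<Rightarrow> (real \<Rightarrow> 'a \<Rightarrow> 'a \<Rightarrow> real) \<Rightarrow> real \<Rightarrow> real \<Rightarrow> ('a \<Rightarrow> real) \<Rightarrow> ennreal" where
  "besov_seminorm \<mu> pt p \<alpha> f =
     (SUP t\<in>{0<..}. ennreal (t powr (- \<alpha>)) *
        ennreal_powr (\<integral>\<^sup>+y. (\<integral>\<^sup>+x. ennreal (\<bar>f x - f y\<bar> powr p * pt t x y) \<partial>\<mu>) \<partial>\<mu>) (1 / p))"

definition besov_space ::
  "'a measure \<Rightarrow> (real \<Rightarrow> 'a \<Rightarrow> 'a \<Rightarrow> real) \<Rightarrow> real \<Rightarrow> real \<Rightarrow> ('a \<Rightarrow> real) set" where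
  "besov_space \<mu> pt p \<alpha> = {f \<in> Lp_space \<mu> p. besov_seminorm \<mu> pt p \<alpha> f < \<top>}"

definition besov_norm ::
  "'a measure \<Rightarrow> (real \<Rightarrow> 'a \<Rightarrow> 'a \<Rightarrow> real) \<Rightarrow> real \<Rightarrow> real \<Rightarrow> ('a \<Rightarrow> real) \<Rightarrow> real" where
  "besov_norm \<mu> pt p \<alpha> f = Lp_norm \<mu> p f + enn2real (besov_seminorm \<mu> pt p \<alpha> f)"

end

theory Submission
  imports Defs
begin

text \<open>
  For \<open>p = 2\<close> the double integral is at most \<open>2 * \<langle>(I - P s) P t f, P t f\<rangle>\<close>, hence at most
  \<open>4 * (s / t) * \<langle>f, f\<rangle>\<close>, because \<open>r \<mapsto> \<langle>P r f, f\<rangle>\<close> is convex, nonnegative and nonincreasing. At the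
  other end, the weak Bakry-Emery estimate says that \<open>f \<mapsto> (P t f x - P t f y) / dist x y powr \<kappa>\<close> is
  bounded on \<open>L\<^sup>\<infinity>\<close>. With the weight \<open>dist x y powr (2 * \<kappa>) * pt s x y\<close> on the product space the
  \<open>L\<^sup>2\<close> estimate concerns the same operator, so that real (Marcinkiewicz) interpolation
  yields the \<open>L\<^sup>p\<close> estimate. The factor \<open>dist x y powr ((p - 2) * \<kappa>)\<close> lost in this way is recovered
  from the sub-Gaussian bounds, which absorb a power of the distance into a change of time:
  \<open>dist x y powr a * pt s x y \<le> A * s powr (a / d\<^sub>W) * pt (\<Lambda> * s) x y\<close>.
\<close>

section \<open>Elementary facts on square integrable and essentially bounded functions\<close>

lemma abs_powr_two: "\<bar>x::real\<bar> powr 2 = x\<^sup>2"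
  by (cases "x = 0") auto

lemma Lp_space_2_iff:
  "f \<in> Lp_space \<mu> 2 \<longleftrightarrow> f \<in> borel_measurable \<mu> \<and> integrable \<mu> (\<lambda>x. (f x)\<^sup>2)"
  by (simp add: Lp_space_def abs_powr_two del: powr_numeral)

lemma L2_inner_self_nonneg: "0 \<le> L2_inner \<mu> f f"
  by (simp add: L2_inner_def)

lemma L2_inner_commute: "L2_inner \<mu> f g = L2_inner \<mu> g f"
  by (simp add: L2_inner_def mult.commute)

lemma Lp_norm_2: "Lp_norm \<mu> 2 f = sqrt (L2_inner \<mu> f f)"
proof -
  have "Lp_norm \<mu> 2 f = (L2_inner \<mu> f f) powr (1/2)"
    by (simp add: Lp_norm_def L2_inner_def abs_powr_two power2_eq_square del: powr_numeral)
  then show ?thesis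
    by (simp add: powr_half_sqrt L2_inner_self_nonneg)
qed

lemma L2_integrable_mult:
  assumes "f \<in> Lp_space \<mu> 2" "g \<in> Lp_space \<mu> 2"
  shows "integrable \<mu> (\<lambda>x. f x * g x)"
proof (rule Bochner_Integration.integrable_bound)
  show "integrable \<mu> (\<lambda>x. (f x)\<^sup>2 + (g x)\<^sup>2)"
    using assms by (simp add: Lp_space_2_iff)
  show "(\<lambda>x. f x * g x) \<in> borel_measurable \<mu>"
    using assms by (auto simp: Lp_space_2_iff)
  have "\<bar>a * b\<bar> \<le> a\<^sup>2 + b\<^sup>2" for a b :: real
  proof -
    have "0 \<le> (\<bar>a\<bar> - \<bar>b\<bar>)\<^sup>2 + \<bar>a\<bar>\<^sup>2 + \<bar>b\<bar>\<^sup>2" by simp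
    then have "0 \<le> 2 * (\<bar>a\<bar>\<^sup>2 + \<bar>b\<bar>\<^sup>2 - \<bar>a\<bar> * \<bar>b\<bar>)"
      by (simp add: power2_eq_square algebra_simps)
    then show ?thesis by (simp add: abs_mult)
  qed
  then show "AE x in \<mu>. norm (f x * g x) \<le> norm ((f x)\<^sup>2 + (g x)\<^sup>2)"
    by auto
qed

lemma L2_inner_cong_AE:
  assumes "f \<in> borel_measurable \<mu>" "g \<in> borel_measurable \<mu>" "h \<in> borel_measurable \<mu>"
    and "AE x in \<mu>. f x = g x"
  shows "L2_inner \<mu> f h = L2_inner \<mu> g h"
  unfolding L2_inner_def using assms by (intro integral_cong_AE) auto

text \<open>\<open>real_of_ereal\<close> sends both infinities to 0, so both have to be excluded:
  the value +infinity by membership, the value -infinity because it forces the measure to be null,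
  where the claim is vacuous.\<close>

lemma AE_abs_le_Linf_norm:
  assumes "f \<in> Linf_space \<mu>"
  shows "AE x in \<mu>. \<bar>f x\<bar> \<le> Linf_norm \<mu> f"
proof -
  obtain K where K: "AE x in \<mu>. \<bar>f x\<bar> \<le> K" and [measurable]: "f \<in> borel_measurable \<mu>"
    using assms by (auto simp: Linf_space_def)
  let ?s = "esssup \<mu> (\<lambda>x. ereal \<bar>f x\<bar>)"
  have le: "?s \<le> ereal K"
    using K by (intro esssup_I) auto
  have ae: "AE x in \<mu>. ereal \<bar>f x\<bar> \<le> ?s"
    by (rule esssup_AE)
  show ?thesis
  proof (cases ?s)
    case (real r)
    then show ?thesis using ae by (simp add: Linf_norm_def)
  next
    case PInf
    then show ?thesis using le by simp
  next
    case MInf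
    then have "AE x in \<mu>. False" using ae by simp
    then show ?thesis by (rule eventually_mono) simp
  qed
qed

text \<open>\<open>0 \<le> K\<close> covers the case of an essential supremum equal to -infinity, in
  which the norm takes the default value 0.\<close>

lemma Linf_normI:
  assumes "f \<in> borel_measurable \<mu>" "AE x in \<mu>. \<bar>f x\<bar> \<le> K" "0 \<le> K"
  shows "f \<in> Linf_space \<mu>" and "Linf_norm \<mu> f \<le> K"
proof -
  show "f \<in> Linf_space \<mu>"
    using assms by (auto simp: Linf_space_def)
  have "esssup \<mu> (\<lambda>x. ereal \<bar>f x\<bar>) \<le> ereal K"
    using assms by (intro esssup_I) auto
  then show "Linf_norm \<mu> f \<le> K"
    using \<open>0 \<le> K\<close> unfolding Linf_norm_def
    by (cases "esssup \<mu> (\<lambda>x. ereal \<bar>f x\<bar>)") auto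
qed

section \<open>Decay of the energy along the semigroup\<close>

text \<open>
  Without the spectral theorem: \<open>r \<mapsto> \<langle>P r f, f\<rangle>\<close> is nonnegative, bounded by \<open>\<langle>f, f\<rangle>\<close> and midpoint
  convex, so its decrements over steps of length \<open>s\<close> are nonincreasing. Hence the decrement at
  \<open>2 * t\<close> is at most the average of about \<open>t / s\<close> earlier ones, whose sum telescopes.
\<close>

lemma midpoint_convex_decrement:
  fixes \<phi> :: "real \<Rightarrow> real"
  assumes conv: "\<And>r s. 0 < r \<Longrightarrow> 0 < s \<Longrightarrow> 2 * \<phi> (r + s) \<le> \<phi> r + \<phi> (r + 2 * s)"
    and nonneg: "\<And>r. 0 < r \<Longrightarrow> 0 \<le> \<phi> r" and le: "\<And>r. 0 < r \<Longrightarrow> \<phi> r \<le> B"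
    and s: "0 < s" and t: "0 < t"
  shows "\<phi> (2 * t) - \<phi> (2 * t + s) \<le> 2 * (s / t) * B"
proof -
  have B: "0 \<le> B" using nonneg[OF t] le[OF t] by simp
  define D where "D = (\<lambda>r. \<phi> r - \<phi> (r + s))"
  have step: "D (r + s) \<le> D r" if "0 < r" for r
  proof -
    have eq: "r + s + s = r + 2 * s" by simp
    show ?thesis using conv[OF that s] unfolding D_def eq by linarith
  qed
  \<comment> \<open>The right-hand side of the first bound is the telescoped sum of the decrements
    at \<open>2 * t - j * s\<close> for j = 1, ..., n, each of them at least
    \<open>D (2 * t)\<close>. The second bound carries this comparison through the induction, and
    \<open>real n * s < 2 * t\<close> keeps all arguments positive.\<close>
  have tel: "real n * D (2 * t) \<le> \<phi> (2 * t - real n * s) - \<phi> (2 * t) \<and> D (2 * t) \<le> D (2 * t - real n * s)"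
    if "real n * s < 2 * t" for n
    using that
  proof (induction n)
    case (Suc n)
    have lt: "real (Suc n) * s < 2 * t" by fact
    have r: "0 < 2 * t - real (Suc n) * s" using lt by simp
    have eq: "2 * t - real (Suc n) * s + s = 2 * t - real n * s"
      by (simp add: algebra_simps)
    have "real n * s < 2 * t" using lt s by (simp add: algebra_simps)
    note IH = Suc.IH[OF this]
    have 1: "D (2 * t - real n * s) \<le> D (2 * t - real (Suc n) * s)"
      using step[OF r] unfolding eq .
    have "D (2 * t - real (Suc n) * s) = \<phi> (2 * t - real (Suc n) * s) - \<phi> (2 * t - real n * s)"
      unfolding D_def eq ..
    moreover have "real (Suc n) * D (2 * t) = real n * D (2 * t) + D (2 * t)"
      by (simp add: algebra_simps)
    ultimately show ?case using IH 1 by linarith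
  qed simp
  show ?thesis
  proof (cases "s \<le> t")
    case True
    \<comment> \<open>At least one step of length \<open>s\<close> fits into \<open>t\<close>, so
      rounding down loses at most a factor 2; this is the 2 in the bound.\<close>
    define n where "n = nat \<lfloor>t / s\<rfloor>"
    have "1 \<le> t / s" using True s by simp
    then have fl: "1 \<le> \<lfloor>t / s\<rfloor>" by simp
    then have n: "real n = real_of_int \<lfloor>t / s\<rfloor>" by (simp add: n_def)
    have n1: "1 \<le> real n" using fl n by linarith
    have "real n \<le> t / s" using n by simp
    then have ns: "real n * s \<le> t" using s by (simp add: field_simps)
    have "t / s < real n + 1" using n by linarith
    then have "t / s \<le> 2 * real n" using n1 by linarith
    then have tn: "t \<le> 2 * s * real n" using s by (simp add: field_simps)
    have lt: "real n * s < 2 * t" using ns t by linarith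
    have "real n * D (2 * t) \<le> B"
      using tel[OF lt] le[of "2 * t - real n * s"] nonneg[of "2 * t"] lt t by linarith
    \<comment> \<open>Only a nonnegative decrement may multiply \<open>tn\<close>; a nonpositive one
      satisfies the bound trivially.\<close>
    show ?thesis
    proof (cases "D (2 * t) \<le> 0")
      case True
      moreover have "0 \<le> 2 * (s / t) * B" using s t B by simp
      ultimately show ?thesis unfolding D_def by linarith
    next
      case False
      have "t * D (2 * t) \<le> 2 * s * real n * D (2 * t)"
        using tn False by (intro mult_right_mono) auto
      also have "\<dots> \<le> 2 * s * B"
        using \<open>real n * D (2 * t) \<le> B\<close> s by (simp add: mult.assoc)
      finally show ?thesis using t by (simp add: D_def field_simps)
    qed
  next
    case False
    \<comment> \<open>For \<open>t < s\<close> a single decrement suffices, because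
      \<open>1 \<le> 2 * (s / t)\<close>.\<close>
    have "D (2 * t) \<le> B"
      unfolding D_def using le[of "2 * t"] nonneg[of "2 * t + s"] s t by linarith
    also have "\<dots> \<le> 2 * (s / t) * B"
      using B False s t by (intro mult_le_cancel_right1[THEN iffD2]) (auto simp: field_simps)
    finally show ?thesis by (simp add: D_def)
  qed
qed

text \<open>Symmetry and the semigroup law turn \<open>L2_inner \<mu> (P a f) (P b f)\<close> into a
  function \<open>\<phi>\<close> of \<open>a + b\<close> alone. The left-hand side is then the
  decrement of \<open>\<phi>\<close> from \<open>2 * t\<close> to \<open>2 * t + s\<close>.\<close>

lemma L2_semigroup_energy_decay:
  assumes P: "L2_semigroup_of_form \<mu> E F P" and f: "f \<in> Lp_space \<mu> 2"
    and s: "0 < s" and t: "0 < t"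
  shows "L2_inner \<mu> (P t f) (P t f) - L2_inner \<mu> (P s (P t f)) (P t f)
    \<le> 2 * (s / t) * L2_inner \<mu> f f"
proof -
  have L2: "P r g \<in> Lp_space \<mu> 2" if "0 < r" "g \<in> Lp_space \<mu> 2" for r g
    using P that by (simp add: L2_semigroup_of_form_def contraction_operator_def)
  have meas: "g \<in> borel_measurable \<mu>" if "g \<in> Lp_space \<mu> 2" for g
    using that by (simp add: Lp_space_2_iff)
  have contr: "L2_inner \<mu> (P r g) (P r g) \<le> L2_inner \<mu> g g" if "0 < r" "g \<in> Lp_space \<mu> 2" for r g
    using P that by (auto simp: L2_semigroup_of_form_def contraction_operator_def Lp_norm_2)
  have semi: "AE x in \<mu>. P (a + b) g x = P a (P b g) x" if "0 < a" "0 < b" "g \<in> Lp_space \<mu> 2" for a b g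
    using P that by (simp add: L2_semigroup_of_form_def)
  have sym: "L2_inner \<mu> (P r g) h = L2_inner \<mu> g (P r h)"
    if "0 < r" "g \<in> Lp_space \<mu> 2" "h \<in> Lp_space \<mu> 2" for r g h
    using P that by (simp add: L2_semigroup_of_form_def)
  define \<phi> where "\<phi> = (\<lambda>r. L2_inner \<mu> (P r f) f)"
  have semi_inner: "L2_inner \<mu> (P a (P b f)) h = L2_inner \<mu> (P (a + b) f) h"
    if "0 < a" "0 < b" "h \<in> Lp_space \<mu> 2" for a b h
  proof (rule L2_inner_cong_AE)
    show "AE x in \<mu>. P a (P b f) x = P (a + b) f x"
      using semi[OF that(1,2) f] by (rule eventually_mono) simp
  qed (use that in \<open>auto intro!: meas L2 f add_pos_pos\<close>)
  have prod: "L2_inner \<mu> (P a f) (P b f) = \<phi> (a + b)" if "0 < a" "0 < b" for a b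
  proof -
    have "L2_inner \<mu> (P a f) (P b f) = L2_inner \<mu> (P b (P a f)) f"
      using that by (simp add: sym L2 f)
    then show ?thesis using that by (simp add: semi_inner f \<phi>_def add.commute)
  qed
  \<comment> \<open>Splitting the time evenly exhibits \<open>\<phi> r\<close> as a squared norm: it
    is nonnegative, and contractivity bounds it.\<close>
  have half: "\<phi> r = L2_inner \<mu> (P (r / 2) f) (P (r / 2) f)" if "0 < r" for r
    using prod[of "r / 2" "r / 2"] that by simp
  have "\<phi> (2 * t) - \<phi> (2 * t + s) \<le> 2 * (s / t) * L2_inner \<mu> f f"
  proof (rule midpoint_convex_decrement[OF _ _ _ s t])
    fix a b :: real assume ab: "0 < a" "0 < b"
    \<comment> \<open>The inner products among \<open>u\<close> and \<open>v\<close> are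
      \<open>\<phi> a\<close>, \<open>\<phi> (a + b)\<close> and \<open>\<phi> (a + 2 * b)\<close>,
      so midpoint convexity is the nonnegativity of the squared norm of
      \<open>u - v\<close>.\<close>
    define u where "u = P (a / 2) f"
    define v where "v = P (a / 2 + b) f"
    have uv: "u \<in> Lp_space \<mu> 2" "v \<in> Lp_space \<mu> 2"
      using ab by (auto simp: u_def v_def L2 f)
    have "0 \<le> (\<integral>x. (u x - v x)\<^sup>2 \<partial>\<mu>)" by simp
    also have "\<dots> = (\<integral>x. u x * u x + v x * v x - 2 * (u x * v x) \<partial>\<mu>)"
      by (intro Bochner_Integration.integral_cong) (auto simp: power2_eq_square algebra_simps)
    also have "\<dots> = L2_inner \<mu> u u + L2_inner \<mu> v v - 2 * L2_inner \<mu> u v"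
      unfolding L2_inner_def using L2_integrable_mult uv
      by (subst Bochner_Integration.integral_diff) auto
    also have "\<dots> = \<phi> a + \<phi> (a + 2 * b) - 2 * \<phi> (a + b)"
      using ab unfolding u_def v_def by (simp add: prod algebra_simps)
    finally show "2 * \<phi> (a + b) \<le> \<phi> a + \<phi> (a + 2 * b)" by simp
  next
    fix r :: real assume r: "0 < r"
    show "0 \<le> \<phi> r" using r by (simp add: half L2_inner_self_nonneg)
    show "\<phi> r \<le> L2_inner \<mu> f f" using r by (simp add: half contr f)
  qed
  moreover have "L2_inner \<mu> (P t f) (P t f) = \<phi> (2 * t)"
    using prod[OF t t] by simp
  moreover have "L2_inner \<mu> (P s (P t f)) (P t f) = \<phi> (2 * t + s)"
    using semi_inner[OF s t L2[OF t f]] prod[of "s + t" t] s t by (simp add: algebra_simps)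
  ultimately show ?thesis by simp
qed

section \<open>Symmetric submarkovian kernels\<close>

lemma (in pair_sigma_finite) AE_fst:
  assumes "AE x in M1. Q x"
  shows "AE z in M1 \<Otimes>\<^sub>M M2. Q (fst z)"
proof -
  obtain N where N: "{x \<in> space M1. \<not> Q x} \<subseteq> N" "emeasure M1 N = 0" "N \<in> sets M1"
    using assms by (rule AE_E)
  show ?thesis
  proof (rule AE_I)
    show "{z \<in> space (M1 \<Otimes>\<^sub>M M2). \<not> Q (fst z)} \<subseteq> N \<times> space M2"
      using N(1) by (auto simp: space_pair_measure)
    show "emeasure (M1 \<Otimes>\<^sub>M M2) (N \<times> space M2) = 0"
      using N by (simp add: M2.emeasure_pair_measure_Times)
  qed (use N in auto)
qed

lemma (in pair_sigma_finite) AE_snd: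
  assumes "AE y in M2. Q y"
  shows "AE z in M1 \<Otimes>\<^sub>M M2. Q (snd z)"
proof -
  obtain N where N: "{x \<in> space M2. \<not> Q x} \<subseteq> N" "emeasure M2 N = 0" "N \<in> sets M2"
    using assms by (rule AE_E)
  show ?thesis
  proof (rule AE_I)
    show "{z \<in> space (M1 \<Otimes>\<^sub>M M2). \<not> Q (snd z)} \<subseteq> space M1 \<times> N"
      using N(1) by (auto simp: space_pair_measure)
    show "emeasure (M1 \<Otimes>\<^sub>M M2) (space M1 \<times> N) = 0"
      using N by (simp add: M2.emeasure_pair_measure_Times)
  qed (use N in auto)
qed

text \<open>The hypothesis tests the kernel on sets of finite measure only, since their indicators
  lie in L2, where the heat kernel represents the semigroup. A nonnull set of points with mass above
  1 would itself be a test set violating it.\<close>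

lemma (in sigma_finite_measure) kernel_mass_le_1:
  fixes k :: "'a \<Rightarrow> 'a \<Rightarrow> ennreal"
  assumes k[measurable]: "case_prod k \<in> borel_measurable (M \<Otimes>\<^sub>M M)"
    and mass: "\<And>A B. A \<in> sets M \<Longrightarrow> B \<in> sets M \<Longrightarrow> emeasure M A < \<infinity> \<Longrightarrow> emeasure M B < \<infinity> \<Longrightarrow>
      (\<integral>\<^sup>+x. (\<integral>\<^sup>+y. indicator A x * (indicator B y * k x y) \<partial>M) \<partial>M) \<le> emeasure M A"
  shows "AE x in M. (\<integral>\<^sup>+y. k x y \<partial>M) \<le> 1"
proof -
  obtain B :: "nat \<Rightarrow> 'a set" where B: "range B \<subseteq> sets M" "(\<Union>i. B i) = space M"
      "\<And>i. emeasure M (B i) \<noteq> \<infinity>" "incseq B"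
    using sigma_finite_incseq by blast
  have [measurable]: "B n \<in> sets M" for n using B by auto
  define v where "v = (\<lambda>n x. \<integral>\<^sup>+y. indicator (B n) y * k x y \<partial>M)"
  have v[measurable]: "v n \<in> borel_measurable M" for n
    unfolding v_def by measurable
  have "AE x in M. x \<notin> {x \<in> B m. 1 < v n x}" for m n
  proof -
    define A where "A = {x \<in> B m. 1 < v n x}"
    have "A = B m \<inter> {x \<in> space M. 1 < v n x}"
      using sets.sets_into_space[of "B m" M] by (auto simp: A_def)
    then have A[measurable]: "A \<in> sets M" by simp
    have "emeasure M A \<le> emeasure M (B m)"
      by (rule emeasure_mono) (auto simp: A_def)
    then have fin: "emeasure M A < \<infinity>"
      using B(3)[of m] by (simp add: less_top le_less_trans top.not_eq_extremum)
    have le: "(\<integral>\<^sup>+x. indicator A x * v n x \<partial>M) \<le> emeasure M A"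
    proof -
      have "(\<integral>\<^sup>+x. indicator A x * v n x \<partial>M)
          = (\<integral>\<^sup>+x. (\<integral>\<^sup>+y. indicator A x * (indicator (B n) y * k x y) \<partial>M) \<partial>M)"
        unfolding v_def by (intro nn_integral_cong) (simp add: nn_integral_cmult)
      then show ?thesis
        using mass[OF A _ fin, of "B n"] B(3)[of n] by (simp add: top.not_eq_extremum)
    qed
    have "AE x in M. indicator A x * v n x \<le> (indicator A x :: ennreal)"
    \<comment> \<open>\<open>v n\<close> exceeds 1 on \<open>A\<close> and \<open>A\<close> has
      finite measure, so if the bound failed on a nonnull set, the integral over \<open>A\<close>
      would be strictly larger than the measure of \<open>A\<close>.\<close>
    proof (rule ccontr)
      assume "\<not> ?thesis"
      then have "(\<integral>\<^sup>+x. indicator A x \<partial>M) < (\<integral>\<^sup>+x. indicator A x * v n x \<partial>M)"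
        using fin
        by (intro nn_integral_less AE_I2) (auto simp: A_def less_imp_le split: split_indicator)
      then show False using le by simp
    qed
    then show ?thesis
      by (rule eventually_mono) (auto simp: A_def split: split_indicator)
  qed
  \<comment> \<open>Countably many pairs share one null set; outside it the bound passes to the
    whole row by monotone convergence along the sets \<open>B n\<close>.\<close>
  then have "AE x in M. \<forall>m n. x \<notin> {x \<in> B m. 1 < v n x}"
    by (intro AE_all_countable[THEN iffD2] allI)
  then show ?thesis
  proof (rule AE_mp[OF _ AE_I2[OF impI]])
    fix x assume x: "x \<in> space M" and *: "\<forall>m n. x \<notin> {x \<in> B m. 1 < v n x}"
    obtain m where "x \<in> B m" using x B(2) by auto
    then have le: "v n x \<le> 1" for n using * by (auto simp: not_less)
    have "(\<integral>\<^sup>+y. k x y \<partial>M) = (\<integral>\<^sup>+y. (SUP n. indicator (B n) y * k x y) \<partial>M)"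
    proof (rule nn_integral_cong)
      fix y assume "y \<in> space M"
      then obtain i where i: "y \<in> B i" using B(2) by auto
      show "k x y = (SUP n. indicator (B n) y * k x y)"
      proof (rule antisym)
        show "k x y \<le> (SUP n. indicator (B n) y * k x y)"
          by (rule SUP_upper2[of i]) (use i in auto)
        show "(SUP n. indicator (B n) y * k x y) \<le> k x y"
          by (rule SUP_least) (auto split: split_indicator)
      qed
    qed
    also have "\<dots> = (SUP n. v n x)"
      unfolding v_def using x
    proof (subst nn_integral_monotone_convergence_SUP)
      show "incseq (\<lambda>n y. indicator (B n) y * k x y)"
        using B(4) by (auto simp: incseq_def le_fun_def split: split_indicator)
    qed auto
    also have "\<dots> \<le> 1" by (rule SUP_least) (rule le)
    finally show "(\<integral>\<^sup>+y. k x y \<partial>M) \<le> 1" .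
  qed
qed

lemma L2_nn_integral:
  assumes "f \<in> Lp_space \<mu> 2"
  shows "(\<integral>\<^sup>+x. ennreal ((f x)\<^sup>2) \<partial>\<mu>) = ennreal (L2_inner \<mu> f f)"
  using assms
  by (subst nn_integral_eq_integral) (auto simp: Lp_space_2_iff L2_inner_def power2_eq_square)

text \<open>By Tonelli, integrating out the second variable first leaves a factor of at most 1. Both
  diagonal terms of the energy are of this kind.\<close>

lemma (in pair_sigma_finite) integrable_weighted_square_fst:
  fixes k :: "'a \<times> 'b \<Rightarrow> real"
  assumes [measurable]: "k \<in> borel_measurable (M1 \<Otimes>\<^sub>M M2)"
    and pos: "AE z in M1 \<Otimes>\<^sub>M M2. 0 \<le> k z"
    and row: "AE x in M1. (\<integral>\<^sup>+y. ennreal (k (x, y)) \<partial>M2) \<le> 1"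
    and f: "f \<in> Lp_space M1 2"
  shows "integrable (M1 \<Otimes>\<^sub>M M2) (\<lambda>z. (f (fst z))\<^sup>2 * k z)"
    and "(\<integral>z. (f (fst z))\<^sup>2 * k z \<partial>(M1 \<Otimes>\<^sub>M M2)) \<le> L2_inner M1 f f"
proof -
  have [measurable]: "f \<in> borel_measurable M1"
    using f by (simp add: Lp_space_2_iff)
  have "(\<integral>\<^sup>+z. ennreal ((f (fst z))\<^sup>2 * k z) \<partial>(M1 \<Otimes>\<^sub>M M2))
      = (\<integral>\<^sup>+x. (\<integral>\<^sup>+y. ennreal ((f x)\<^sup>2) * ennreal (k (x, y)) \<partial>M2) \<partial>M1)"
    by (subst M2.nn_integral_fst[symmetric]) (auto simp: ennreal_mult')
  also have "\<dots> = (\<integral>\<^sup>+x. ennreal ((f x)\<^sup>2) * (\<integral>\<^sup>+y. ennreal (k (x, y)) \<partial>M2) \<partial>M1)"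
    by (intro nn_integral_cong nn_integral_cmult) auto
  also have "\<dots> \<le> (\<integral>\<^sup>+x. ennreal ((f x)\<^sup>2) * 1 \<partial>M1)"
    using row by (intro nn_integral_mono_AE) (auto elim!: eventually_mono intro!: mult_left_mono simp del: mult_1_right)
  also have "\<dots> = ennreal (L2_inner M1 f f)"
    using f by (simp add: L2_nn_integral)
  finally have le: "(\<integral>\<^sup>+z. ennreal ((f (fst z))\<^sup>2 * k z) \<partial>(M1 \<Otimes>\<^sub>M M2)) \<le> ennreal (L2_inner M1 f f)" .
  have pos': "AE z in M1 \<Otimes>\<^sub>M M2. 0 \<le> (f (fst z))\<^sup>2 * k z"
    using pos by (rule eventually_mono) simp
  show int: "integrable (M1 \<Otimes>\<^sub>M M2) (\<lambda>z. (f (fst z))\<^sup>2 * k z)"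
    using le pos' by (intro integrableI_nonneg) (auto simp: le_less_trans)
  show "(\<integral>z. (f (fst z))\<^sup>2 * k z \<partial>(M1 \<Otimes>\<^sub>M M2)) \<le> L2_inner M1 f f"
    using le nn_integral_eq_integral[OF int pos'] L2_inner_self_nonneg by (metis ennreal_le_iff)
qed

text \<open>Expanding the square gives two diagonal terms, controlled by the row and column masses,
  minus twice a cross term, which is \<open>L2_inner M h f\<close> because \<open>h\<close> is the
  kernel applied to \<open>f\<close>.\<close>

lemma (in sigma_finite_measure) kernel_energy_le:
  fixes k :: "'a \<Rightarrow> 'a \<Rightarrow> real"
  assumes k[measurable]: "case_prod k \<in> borel_measurable (M \<Otimes>\<^sub>M M)"
    and pos: "AE (x, y) in M \<Otimes>\<^sub>M M. 0 \<le> k x y"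
    and row: "AE x in M. (\<integral>\<^sup>+y. ennreal (k x y) \<partial>M) \<le> 1"
    and col: "AE y in M. (\<integral>\<^sup>+x. ennreal (k x y) \<partial>M) \<le> 1"
    and f: "f \<in> Lp_space M 2" and h: "h \<in> borel_measurable M"
    and hk: "AE x in M. h x = (\<integral>y. k x y * f y \<partial>M)"
  shows "(\<integral>\<^sup>+(x, y). ennreal ((f x - f y)\<^sup>2 * k x y) \<partial>(M \<Otimes>\<^sub>M M))
    \<le> ennreal (2 * (L2_inner M f f - L2_inner M h f))"
proof -
  interpret pair_sigma_finite M M ..
  have [measurable]: "f \<in> borel_measurable M"
    using f by (simp add: Lp_space_2_iff)
  let ?k = "\<lambda>z. k (fst z) (snd z)"
  have pos': "AE z in M \<Otimes>\<^sub>M M. 0 \<le> ?k z"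
    using pos by (simp add: case_prod_beta)
  have 1: "integrable (M \<Otimes>\<^sub>M M) (\<lambda>z. (f (fst z))\<^sup>2 * ?k z)"
      "(\<integral>z. (f (fst z))\<^sup>2 * ?k z \<partial>(M \<Otimes>\<^sub>M M)) \<le> L2_inner M f f"
    using integrable_weighted_square_fst[of ?k f] pos' row f by auto
  \<comment> \<open>Transposing the kernel makes the column bound a row bound; swapping the
    coordinates back gives the diagonal term in the second variable.\<close>
  let ?k' = "\<lambda>(y, x). k x y"
  have k'[measurable]: "?k' \<in> borel_measurable (M \<Otimes>\<^sub>M M)"
    using measurable_pair_swap[OF k] by (simp add: case_prod_beta)
  have swap_pos: "AE z in M \<Otimes>\<^sub>M M. 0 \<le> ?k' z"
  proof -
    have "AE x in M. AE y in M. 0 \<le> k x y"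
      using AE_pair[OF pos] by simp
    then have "AE y in M. AE x in M. 0 \<le> k x y"
      by (subst (asm) AE_commute) auto
    then show ?thesis
      by (intro AE_pair_measure) auto
  qed
  have 2: "integrable (M \<Otimes>\<^sub>M M) (\<lambda>z. (f (fst z))\<^sup>2 * ?k' z)"
      "(\<integral>z. (f (fst z))\<^sup>2 * ?k' z \<partial>(M \<Otimes>\<^sub>M M)) \<le> L2_inner M f f"
    using integrable_weighted_square_fst[of ?k' f] swap_pos col f by auto
  have 3: "integrable (M \<Otimes>\<^sub>M M) (\<lambda>z. (f (snd z))\<^sup>2 * ?k z)"
    using integrable_product_swap[OF 2(1)] by (simp add: case_prod_beta')
  have 4: "(\<integral>z. (f (snd z))\<^sup>2 * ?k z \<partial>(M \<Otimes>\<^sub>M M)) \<le> L2_inner M f f"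
    using 2(2) integral_product_swap[of "\<lambda>z. (f (fst z))\<^sup>2 * ?k' z"] by (simp add: case_prod_beta')
  \<comment> \<open>The two diagonal terms dominate the cross term, so the three integrals may be
    taken separately.\<close>
  have 5: "integrable (M \<Otimes>\<^sub>M M) (\<lambda>z. f (fst z) * (?k z * f (snd z)))"
  proof (rule Bochner_Integration.integrable_bound)
    show "integrable (M \<Otimes>\<^sub>M M) (\<lambda>z. (f (fst z))\<^sup>2 * ?k z + (f (snd z))\<^sup>2 * ?k z)"
      using 1(1) 3 by simp
    show "AE z in M \<Otimes>\<^sub>M M. norm (f (fst z) * (?k z * f (snd z)))
        \<le> norm ((f (fst z))\<^sup>2 * ?k z + (f (snd z))\<^sup>2 * ?k z)"
      using pos'
    proof (rule eventually_mono)
      fix z assume nn: "0 \<le> ?k z"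
      have "\<bar>f (fst z)\<bar> * \<bar>f (snd z)\<bar> \<le> (f (fst z))\<^sup>2 + (f (snd z))\<^sup>2"
      proof -
        have "0 \<le> (\<bar>f (fst z)\<bar> - \<bar>f (snd z)\<bar>)\<^sup>2 + \<bar>f (fst z)\<bar>\<^sup>2 + \<bar>f (snd z)\<bar>\<^sup>2" by simp
        then have "0 \<le> 2 * (\<bar>f (fst z)\<bar>\<^sup>2 + \<bar>f (snd z)\<bar>\<^sup>2 - \<bar>f (fst z)\<bar> * \<bar>f (snd z)\<bar>)"
          by (simp add: power2_eq_square algebra_simps)
        then show ?thesis by simp
      qed
      then have "\<bar>f (fst z)\<bar> * \<bar>f (snd z)\<bar> * ?k z \<le> ((f (fst z))\<^sup>2 + (f (snd z))\<^sup>2) * ?k z"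
        using nn by (rule mult_right_mono)
      then show "norm (f (fst z) * (?k z * f (snd z)))
          \<le> norm ((f (fst z))\<^sup>2 * ?k z + (f (snd z))\<^sup>2 * ?k z)"
        using nn by (simp add: abs_mult algebra_simps)
    qed
  qed measurable
  have 6: "(\<integral>z. f (fst z) * (?k z * f (snd z)) \<partial>(M \<Otimes>\<^sub>M M)) = L2_inner M h f"
  proof -
    have "(\<integral>z. f (fst z) * (?k z * f (snd z)) \<partial>(M \<Otimes>\<^sub>M M)) = (\<integral>x. \<integral>y. f x * (k x y * f y) \<partial>M \<partial>M)"
      using integral_fst'[OF 5] by simp
    also have "\<dots> = (\<integral>x. h x * f x \<partial>M)"
    proof (rule integral_cong_AE)
      show "AE x in M. (\<integral>y. f x * (k x y * f y) \<partial>M) = h x * f x"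
        using hk by (rule eventually_mono) simp
      show "(\<lambda>x. \<integral>y. f x * (k x y * f y) \<partial>M) \<in> borel_measurable M"
        by measurable
    qed (use h in measurable)
    finally show ?thesis by (simp add: L2_inner_def)
  qed
  let ?e = "\<lambda>z. (f (fst z))\<^sup>2 * ?k z + (f (snd z))\<^sup>2 * ?k z - 2 * (f (fst z) * (?k z * f (snd z)))"
  have eq: "(f x - f y)\<^sup>2 * k x y = ?e (x, y)" for x y
    by (simp add: power2_eq_square algebra_simps)
  have int: "integrable (M \<Otimes>\<^sub>M M) ?e"
    using 1 3 5 by simp
  have "(\<integral>\<^sup>+(x, y). ennreal ((f x - f y)\<^sup>2 * k x y) \<partial>(M \<Otimes>\<^sub>M M)) = (\<integral>\<^sup>+z. ennreal (?e z) \<partial>(M \<Otimes>\<^sub>M M))"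
    by (intro nn_integral_cong) (auto simp: eq)
  also have "\<dots> = ennreal (\<integral>z. ?e z \<partial>(M \<Otimes>\<^sub>M M))"
  proof (rule nn_integral_eq_integral[OF int])
    show "AE z in M \<Otimes>\<^sub>M M. 0 \<le> ?e z"
      using pos'
    proof (rule eventually_mono)
      fix z assume "0 \<le> ?k z"
      then have "0 \<le> (f (fst z) - f (snd z))\<^sup>2 * ?k z" by simp
      then show "0 \<le> ?e z" using eq[of "fst z" "snd z"] by simp
    qed
  qed
  also have "\<dots> \<le> ennreal (2 * (L2_inner M f f - L2_inner M h f))"
    using 1 3 4 5 6 by (intro ennreal_leI) simp
  finally show ?thesis .
qed

section \<open>Spaces with relatively compact balls\<close>

text \<open>Compact sets are totally bounded: the finite nets of mesh 1/(m+1) for the balls of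
  radius n about one arbitrary point are together dense and countable.\<close>

lemma countable_dense_of_bounded_compact:
  assumes "\<And>(x :: 'a::metric_space) r. compact (closure (ball x r))"
  obtains D :: "'a::metric_space set" where "countable D" "\<And>x e. 0 < e \<Longrightarrow> \<exists>q\<in>D. dist x q < e"
proof -
  define a :: 'a where "a = undefined"
  have "\<exists>k. finite k \<and> closure (ball a (real n)) \<subseteq> (\<Union>x\<in>k. ball x (inverse (real (Suc m))))" for n m
    using assms[of a "real n"] by (simp add: compact_eq_totally_bounded)
  then obtain k where k: "\<And>n m. finite (k n m)"
      "\<And>n m. closure (ball a (real n)) \<subseteq> (\<Union>x\<in>k n m. ball x (inverse (real (Suc m))))"
    by metis
  show thesis
  proof
    show "countable (\<Union>n m. k n m)"
      using k(1) by (intro countable_UN) (auto intro: countable_finite)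
    fix x :: 'a and e :: real assume "0 < e"
    then obtain m where m: "inverse (real (Suc m)) < e" using reals_Archimedean by blast
    obtain n where "dist a x < real n" using reals_Archimedean2 by blast
    then have "x \<in> closure (ball a (real n))" by (intro subsetD[OF closure_subset]) simp
    then obtain q where "q \<in> k n m" "x \<in> ball q (inverse (real (Suc m)))" using k(2) by blast
    then show "\<exists>q\<in>\<Union>n m. k n m. dist x q < e"
      using m by (intro bexI[of _ q]) (auto simp: dist_commute)
  qed
qed

text \<open>
  The metric need not be second countable as a type, so joint measurability of the distance for the
  product \<open>\<sigma>\<close>-algebra has to be derived from separability.
\<close>

lemma borel_measurable_dist_pair:
  fixes \<mu> :: "'a::metric_space measure"
  assumes "\<And>(x :: 'a) r. compact (closure (ball x r))"
    and sets[measurable_cong]: "sets \<mu> = sets borel"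
  shows "(\<lambda>z. dist (fst z) (snd z)) \<in> borel_measurable (\<mu> \<Otimes>\<^sub>M \<mu>)"
proof -
  obtain D :: "'a set" where D: "countable D" "\<And>x e. 0 < e \<Longrightarrow> \<exists>q\<in>D. dist x q < e"
    using countable_dense_of_bounded_compact assms(1) by blast
  have ne: "D \<noteq> {}" using D(2)[of 1 undefined] by auto
  \<comment> \<open>Each term of the infimum is a sum of functions of one variable, hence measurable
    on the product. A point \<open>q\<close> within e/2 of \<open>x\<close> exceeds the distance by
    at most e, since \<open>dist x q\<close> is paid twice.\<close>
  have eq: "dist x y = (INF q\<in>D. dist x q + dist y q)" for x y :: 'a
  proof (rule antisym)
    show "dist x y \<le> (INF q\<in>D. dist x q + dist y q)"
      using ne by (intro cINF_greatest) (auto intro: dist_triangle2)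
    show "(INF q\<in>D. dist x q + dist y q) \<le> dist x y"
    proof (rule field_le_epsilon)
      fix e :: real assume "0 < e"
      then obtain q where q: "q \<in> D" "dist x q < e / 2" using D(2)[of "e / 2" x] by auto
      have "(INF q\<in>D. dist x q + dist y q) \<le> dist x q + dist y q"
        using q by (intro cINF_lower bdd_belowI2[of _ 0]) auto
      also have "\<dots> \<le> dist x y + e"
        using q dist_triangle[of y q x] by (simp add: dist_commute)
      finally show "(INF q\<in>D. dist x q + dist y q) \<le> dist x y + e" .
    qed
  qed
  have [measurable]: "(\<lambda>x. dist x q) \<in> borel_measurable \<mu>" for q :: 'a
  proof -
    have "(\<lambda>x. dist x q) \<in> borel_measurable borel"
      by (intro borel_measurable_continuous_onI continuous_intros)
    then show ?thesis using sets by (simp cong: measurable_cong_sets)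
  qed
  have "(\<lambda>z. INF q\<in>D. dist (fst z) q + dist (snd z) q) \<in> borel_measurable (\<mu> \<Otimes>\<^sub>M \<mu>)"
    by (intro borel_measurable_cINF D(1) bdd_belowI2[of _ 0]) auto
  then show ?thesis unfolding eq[symmetric] .
qed

lemma sigma_finite_Ahlfors_regular:
  fixes \<mu> :: "'a::metric_space measure"
  assumes "Ahlfors_regular \<mu> d" and sets: "sets \<mu> = sets borel"
  shows "sigma_finite_measure \<mu>"
proof
  obtain c where c: "\<And>(x :: 'a) r. 0 < r \<Longrightarrow> emeasure \<mu> (ball x r) \<le> ennreal (c * r powr d)"
    using assms(1) by (auto simp: Ahlfors_regular_def)
  \<comment> \<open>The radii start at 1 because the volume bound is available for positive
    radii.\<close>
  let ?A = "range (\<lambda>n. ball (undefined :: 'a) (real (Suc n)))"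
  have "\<exists>n. dist undefined x < real (Suc n)" for x :: 'a
    using reals_Archimedean2[of "dist undefined x"] by (metis less_Suc_eq of_nat_less_iff order.strict_trans)
  then have "\<Union> ?A = space \<mu>"
    using sets_eq_imp_space_eq[OF sets] by auto
  moreover have "\<forall>a\<in>?A. emeasure \<mu> a \<noteq> \<infinity>"
    using neq_top_trans[OF ennreal_neq_top c] by auto
  ultimately show "\<exists>A. countable A \<and> A \<subseteq> sets \<mu> \<and> \<Union> A = space \<mu> \<and> (\<forall>a\<in>A. emeasure \<mu> a \<noteq> \<infinity>)"
    using sets by (intro exI[of _ ?A]) auto
qed

section \<open>Real interpolation\<close>

text \<open>\<open>0 < q\<close> keeps the power integrable at 0, and the endpoints of the interval
  are null. It is used with q = p and with q = p - 2.\<close>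

lemma powr_layer_cake:
  fixes q u :: real
  assumes q: "0 < q" and u: "0 \<le> u"
  shows "(\<integral>\<^sup>+l. ennreal (l powr (q - 1)) * indicator {l. 0 < l \<and> l < u} l \<partial>lborel) = ennreal (u powr q / q)"
proof -
  have I: "((\<lambda>l. l powr (q - 1)) has_integral (u powr q / q)) {0..u}"
    using has_integral_powr_from_0[of "q - 1" u] q u by simp
  have "(\<integral>\<^sup>+l. ennreal (indicator {0..u} l * l powr (q - 1)) \<partial>lborel) = ennreal (u powr q / q)"
    by (rule nn_integral_has_integral_lebesgue[OF _ I]) simp
  also have "(\<integral>\<^sup>+l. ennreal (indicator {0..u} l * l powr (q - 1)) \<partial>lborel) =
      (\<integral>\<^sup>+l. ennreal (l powr (q - 1)) * indicator {l. 0 < l \<and> l < u} l \<partial>lborel)"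
  proof (rule nn_integral_cong_AE)
    show "AE l in lborel. ennreal (indicator {0..u} l * l powr (q - 1)) =
        ennreal (l powr (q - 1)) * indicator {l. 0 < l \<and> l < u} l"
      using AE_lborel_singleton[of 0] AE_lborel_singleton[of u]
      by eventually_elim (auto split: split_indicator)
  qed
  finally show ?thesis .
qed

text \<open>Marcinkiewicz's argument with the truncation built into the hypothesis: at level
  \<open>l\<close> only the part of \<open>f\<close> above \<open>g * l\<close> counts. The levels
  of \<open>u\<close> are integrated, the weak bound is applied at each of them, and after Fubini
  the levels of \<open>\<bar>f x\<bar> / g\<close> are integrated with exponent
  \<open>p - 2\<close>, positive by \<open>2 < p\<close>.\<close>

lemma weak_type_interpolation:
  fixes u :: "'a \<Rightarrow> real" and f :: "'b \<Rightarrow> real"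
  assumes M: "sigma_finite_measure M" and N: "sigma_finite_measure N"
    and [measurable]: "w \<in> borel_measurable M" "u \<in> borel_measurable M" "f \<in> borel_measurable N"
    and u: "\<And>z. 0 \<le> u z" and p: "2 < p" and K: "0 \<le> K" and g: "0 < g"
    and int: "integrable N (\<lambda>x. \<bar>f x\<bar> powr p)"
    and weak_type: "\<And>l. 0 < l \<Longrightarrow> (\<integral>\<^sup>+z. w z * indicator {z. l < u z} z \<partial>M)
      \<le> ennreal (K / l\<^sup>2) * (\<integral>\<^sup>+x. ennreal ((f x)\<^sup>2) * indicator {x. g * l < \<bar>f x\<bar>} x \<partial>N)"
  shows "(\<integral>\<^sup>+z. w z * ennreal (u z powr p) \<partial>M)
    \<le> ennreal (p * K / ((p - 2) * g powr (p - 2)) * (\<integral>x. \<bar>f x\<bar> powr p \<partial>N))"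
proof -
  interpret MP: pair_sigma_finite M lborel using M by (simp add: pair_sigma_finite_def sigma_finite_lborel)
  interpret NP: pair_sigma_finite N lborel using N by (simp add: pair_sigma_finite_def sigma_finite_lborel)
  have ennreal_mult3: "ennreal a * (ennreal b * ennreal c) = ennreal (a * (b * c))"
    if "0 \<le> a" "0 \<le> b" "0 \<le> c" for a b c
    using that by (simp add: ennreal_mult)
  have cake: "ennreal (u z powr p) = ennreal p *
      (\<integral>\<^sup>+l. ennreal (l powr (p - 1)) * indicator {l. 0 < l \<and> l < u z} l \<partial>lborel)" for z
    using p u[of z] by (simp add: powr_layer_cake flip: ennreal_mult')
  have "(\<integral>\<^sup>+z. w z * ennreal (u z powr p) \<partial>M) = (\<integral>\<^sup>+z. (\<integral>\<^sup>+l. ennreal p * (w z *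
      (ennreal (l powr (p - 1)) * indicator {l. 0 < l \<and> l < u z} l)) \<partial>lborel) \<partial>M)"
    unfolding cake by (simp add: nn_integral_cmult mult_ac)
  also have "\<dots> = (\<integral>\<^sup>+l. (\<integral>\<^sup>+z. ennreal p * (w z *
      (ennreal (l powr (p - 1)) * indicator {l. 0 < l \<and> l < u z} l)) \<partial>M) \<partial>lborel)"
    by (rule MP.Fubini'[symmetric]) measurable
  also have "\<dots> \<le> (\<integral>\<^sup>+l. (\<integral>\<^sup>+x. ennreal (p * K) * (ennreal ((f x)\<^sup>2) * (ennreal (l powr (p - 2 - 1)) *
      indicator {l. 0 < l \<and> l < \<bar>f x\<bar> / g} l)) \<partial>N) \<partial>lborel)"
  proof (rule nn_integral_mono)
    fix l :: real
    show "(\<integral>\<^sup>+z. ennreal p * (w z * (ennreal (l powr (p - 1)) * indicator {l. 0 < l \<and> l < u z} l)) \<partial>M)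
      \<le> (\<integral>\<^sup>+x. ennreal (p * K) * (ennreal ((f x)\<^sup>2) * (ennreal (l powr (p - 2 - 1)) *
          indicator {l. 0 < l \<and> l < \<bar>f x\<bar> / g} l)) \<partial>N)"
    proof (cases "0 < l")
      case True
      have "(\<integral>\<^sup>+z. ennreal p * (w z * (ennreal (l powr (p - 1)) * indicator {l. 0 < l \<and> l < u z} l)) \<partial>M)
          = (\<integral>\<^sup>+z. ennreal (p * l powr (p - 1)) * (w z * indicator {z. l < u z} z) \<partial>M)"
        using True p by (intro nn_integral_cong) (auto simp: ennreal_mult' mult_ac split: split_indicator)
      also have "\<dots> = ennreal (p * l powr (p - 1)) * (\<integral>\<^sup>+z. w z * indicator {z. l < u z} z \<partial>M)"
        by (rule nn_integral_cmult) measurable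
      also have "\<dots> \<le> ennreal (p * l powr (p - 1)) * (ennreal (K / l\<^sup>2) *
          (\<integral>\<^sup>+x. ennreal ((f x)\<^sup>2) * indicator {x. g * l < \<bar>f x\<bar>} x \<partial>N))"
        by (intro mult_left_mono weak_type True) auto
      \<comment> \<open>The inverse square of \<open>l\<close> lowers the exponent
        \<open>p - 1\<close> to \<open>p - 3\<close>, written so as to fit
        \<open>powr_layer_cake\<close> with q = p - 2.\<close>
      also have "\<dots> = ennreal (p * K * l powr (p - 2 - 1)) *
          (\<integral>\<^sup>+x. ennreal ((f x)\<^sup>2) * indicator {x. g * l < \<bar>f x\<bar>} x \<partial>N)"
      proof -
        have "l powr (p - 1) = l powr (p - 2 - 1) * l powr 2"
          unfolding powr_add[symmetric] by simp
        then have "p * l powr (p - 1) * (K / l\<^sup>2) = p * K * l powr (p - 2 - 1)"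
          using True by (simp add: field_simps)
        moreover have "ennreal (p * l powr (p - 1)) * ennreal (K / l\<^sup>2) = ennreal (p * l powr (p - 1) * (K / l\<^sup>2))"
          using p K by (intro ennreal_mult'[symmetric]) simp
        ultimately show ?thesis by (simp add: mult.assoc[symmetric])
      qed
      also have "\<dots> = (\<integral>\<^sup>+x. ennreal (p * K * l powr (p - 2 - 1)) *
          (ennreal ((f x)\<^sup>2) * indicator {x. g * l < \<bar>f x\<bar>} x) \<partial>N)"
        by (rule nn_integral_cmult[symmetric]) measurable
      \<comment> \<open>The condition \<open>g * l < \<bar>f x\<bar>\<close> is now read as an upper
        bound on \<open>l\<close>, ready for integrating in \<open>l\<close> first.\<close>
      also have "\<dots> = (\<integral>\<^sup>+x. ennreal (p * K) * (ennreal ((f x)\<^sup>2) * (ennreal (l powr (p - 2 - 1)) *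
          indicator {l. 0 < l \<and> l < \<bar>f x\<bar> / g} l)) \<partial>N)"
        using True g p K
        by (intro nn_integral_cong) (auto simp: ennreal_mult' field_simps split: split_indicator)
      finally show ?thesis .
    qed simp
  qed
  also have "\<dots> = (\<integral>\<^sup>+x. (\<integral>\<^sup>+l. ennreal (p * K) * (ennreal ((f x)\<^sup>2) * (ennreal (l powr (p - 2 - 1)) *
      indicator {l. 0 < l \<and> l < \<bar>f x\<bar> / g} l)) \<partial>lborel) \<partial>N)"
    by (rule NP.Fubini') measurable
  also have "\<dots> = (\<integral>\<^sup>+x. ennreal (p * K / ((p - 2) * g powr (p - 2)) * \<bar>f x\<bar> powr p) \<partial>N)"
  proof (rule nn_integral_cong)
    fix x
    have "(\<integral>\<^sup>+l. ennreal (p * K) * (ennreal ((f x)\<^sup>2) * (ennreal (l powr (p - 2 - 1)) *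
        indicator {l. 0 < l \<and> l < \<bar>f x\<bar> / g} l)) \<partial>lborel)
        = ennreal (p * K) * (ennreal ((f x)\<^sup>2) * ennreal ((\<bar>f x\<bar> / g) powr (p - 2) / (p - 2)))"
      using p g powr_layer_cake[of "p - 2" "\<bar>f x\<bar> / g"] by (simp add: nn_integral_cmult)
    also have "\<dots> = ennreal (p * K * ((f x)\<^sup>2 * ((\<bar>f x\<bar> / g) powr (p - 2) / (p - 2))))"
      using p K by (intro ennreal_mult3) auto
    also have "p * K * ((f x)\<^sup>2 * ((\<bar>f x\<bar> / g) powr (p - 2) / (p - 2)))
        = p * K / ((p - 2) * g powr (p - 2)) * \<bar>f x\<bar> powr p"
    proof -
      have "\<bar>f x\<bar> powr p = \<bar>f x\<bar> powr 2 * \<bar>f x\<bar> powr (p - 2)"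
        unfolding powr_add[symmetric] by simp
      then have "\<bar>f x\<bar> powr p = (f x)\<^sup>2 * \<bar>f x\<bar> powr (p - 2)"
        by (simp add: abs_powr_two)
      then show ?thesis
        using g by (simp add: powr_divide)
    qed
    finally show "(\<integral>\<^sup>+l. ennreal (p * K) * (ennreal ((f x)\<^sup>2) * (ennreal (l powr (p - 2 - 1)) *
        indicator {l. 0 < l \<and> l < \<bar>f x\<bar> / g} l)) \<partial>lborel)
        = ennreal (p * K / ((p - 2) * g powr (p - 2)) * \<bar>f x\<bar> powr p)" .
  qed
  also have "\<dots> = ennreal (p * K / ((p - 2) * g powr (p - 2)) * (\<integral>x. \<bar>f x\<bar> powr p \<partial>N))"
    using int p K g by (subst nn_integral_eq_integral) auto
  finally show ?thesis .
qed

section \<open>Comparison of heat kernels at different times\<close>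

text \<open>The maximum is attained at z = b/c; the witness is its value without the factor exp(-b).
  The bound comes from ln y \<le> y - 1 at y = c z / b.\<close>

lemma powr_mult_exp_bounded:
  fixes b c :: real
  assumes "0 \<le> b" "0 < c"
  obtains A where "0 < A" "\<And>z. 0 \<le> z \<Longrightarrow> z powr b * exp (- c * z) \<le> A"
proof
  show "0 < exp (b * ln (b / c))" by simp
  fix z :: real assume z: "0 \<le> z"
  show "z powr b * exp (- c * z) \<le> exp (b * ln (b / c))"
  proof (cases "b = 0 \<or> z = 0")
    case True
    then show ?thesis using assms z by (auto simp: mult_le_0_iff)
  next
    case False
    then have pos: "0 < b" "0 < z" using assms z by auto
    have "ln (c * z / b) \<le> c * z / b - 1"
      using pos assms by (intro ln_le_minus_one) auto
    moreover have "ln (c * z / b) = ln z - ln (b / c)"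
      using pos assms by (simp add: ln_div ln_mult)
    ultimately have "b * (ln z - ln (b / c)) \<le> b * (c * z / b - 1)"
      using pos by (intro mult_left_mono) auto
    then have "b * ln z - c * z \<le> b * ln (b / c)"
      using pos by (simp add: right_diff_distrib)
    moreover have "z powr b * exp (- c * z) = exp (b * ln z - c * z)"
      using pos by (simp add: powr_def exp_diff exp_minus field_simps)
    ultimately show ?thesis by simp
  qed
qed

text \<open>The exponential in the upper bound at time \<open>s\<close> splits into two equal
  factors: one absorbs the power of the distance, the other is matched with the lower bound at time
  \<open>\<Lambda> * s\<close>.\<close>

lemma sub_Gaussian_weight:
  fixes \<mu> :: "'a::metric_space measure"
  assumes "sub_Gaussian \<mu> pt dH dW" and a: "0 \<le> a"
  obtains \<Lambda> A :: real where "0 < \<Lambda>" "0 < A"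
    "\<And>s. 0 < s \<Longrightarrow> AE (x, y) in \<mu> \<Otimes>\<^sub>M \<mu>. dist x y powr a * pt s x y \<le> A * s powr (a / dW) * pt (\<Lambda> * s) x y"
proof -
  have dW: "2 \<le> dW" using assms by (simp add: sub_Gaussian_def)
  obtain c3 c4 c5 c6 where c: "0 < c3" "0 < c4" "0 < c5" "0 < c6"
    and hk: "\<And>t. 0 < t \<Longrightarrow> AE (x, y) in \<mu> \<Otimes>\<^sub>M \<mu>.
        c5 * t powr (- dH / dW) * exp (- c6 * (dist x y powr dW / t) powr (1 / (dW - 1))) \<le> pt t x y \<and>
        pt t x y \<le> c3 * t powr (- dH / dW) * exp (- c4 * (dist x y powr dW / t) powr (1 / (dW - 1)))"
    using assms unfolding sub_Gaussian_def by blast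
  \<comment> \<open>The exponent for which \<open>d powr a = s powr (a / dW) * z powr b\<close> in
    the scaled variable \<open>z\<close> below.\<close>
  define b where "b = a * (dW - 1) / dW"
  have b: "0 \<le> b" using a dW by (simp add: b_def)
  obtain A0 where A0: "0 < A0" "\<And>z. 0 \<le> z \<Longrightarrow> z powr b * exp (- (c4 / 2) * z) \<le> A0"
    using powr_mult_exp_bounded[OF b, of "c4 / 2"] c by auto
  \<comment> \<open>Chosen so that rescaling time by \<open>\<Lambda>\<close> turns the rate
    \<open>c6\<close> of the lower bound into \<open>c4 / 2\<close>, the rate of the remaining half
    exponential.\<close>
  define \<Lambda> where "\<Lambda> = (2 * c6 / c4) powr (dW - 1)"
  have \<Lambda>: "0 < \<Lambda>" using c by (simp add: \<Lambda>_def)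
  have \<Lambda>': "\<Lambda> powr (1 / (dW - 1)) = 2 * c6 / c4"
    using c dW by (simp add: \<Lambda>_def powr_powr)
  \<comment> \<open>The denominator cancels the prefactor that the lower bound at time
    \<open>\<Lambda> * s\<close> brings in.\<close>
  define A where "A = c3 * A0 / (c5 * \<Lambda> powr (- dH / dW))"
  have A: "0 < A" using c A0 \<Lambda> by (simp add: A_def)
  show thesis
  proof (rule that[OF \<Lambda> A])
    fix s :: real assume s: "0 < s"
    then have \<Lambda>s: "0 < \<Lambda> * s" using \<Lambda> by simp
    show "AE (x, y) in \<mu> \<Otimes>\<^sub>M \<mu>. dist x y powr a * pt s x y \<le> A * s powr (a / dW) * pt (\<Lambda> * s) x y"
      using hk[OF s] hk[OF \<Lambda>s]
    proof (eventually_elim, safe)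
      fix x y :: 'a
      define d where "d = dist x y"
      define z where "z = (d powr dW / s) powr (1 / (dW - 1))"
      have d: "0 \<le> d" and z: "0 \<le> z" by (simp_all add: d_def z_def)
      assume up: "pt s x y \<le> c3 * s powr (- dH / dW) * exp (- c4 * (dist x y powr dW / s) powr (1 / (dW - 1)))"
        and lo: "c5 * (\<Lambda> * s) powr (- dH / dW) *
          exp (- c6 * (dist x y powr dW / (\<Lambda> * s)) powr (1 / (dW - 1))) \<le> pt (\<Lambda> * s) x y"
      have "(d powr dW / (\<Lambda> * s)) powr (1 / (dW - 1)) = z / \<Lambda> powr (1 / (dW - 1))"
      proof -
        have "d powr dW / (\<Lambda> * s) = (d powr dW / s) / \<Lambda>" by simp
        then show ?thesis
          unfolding z_def using s \<Lambda> by (metis divide_nonneg_pos less_imp_le powr_divide powr_ge_zero)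
      qed
      then have z\<Lambda>: "- c6 * (d powr dW / (\<Lambda> * s)) powr (1 / (dW - 1)) = - (c4 / 2) * z"
        unfolding \<Lambda>' using c by (simp add: field_simps)
      \<comment> \<open>At \<open>d = 0\<close> both sides vanish, since \<open>0 powr x\<close> is
        0 even for the exponent 0.\<close>
      have da: "d powr a = s powr (a / dW) * z powr b"
      proof (cases "d = 0")
        case True
        then show ?thesis by (simp add: z_def)
      next
        case False
        have "z powr b = (d powr dW / s) powr (a / dW)"
          using dW by (simp add: z_def b_def powr_powr)
        also have "\<dots> = d powr a / s powr (a / dW)"
          using dW d s by (simp add: powr_divide powr_powr)
        finally show ?thesis using s by simp
      qed
      have "d powr a * pt s x y \<le> d powr a * (c3 * s powr (- dH / dW) * exp (- c4 * z))"
        using up by (intro mult_left_mono) (auto simp: d_def z_def)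
      also have "\<dots> = c3 * s powr (- dH / dW) * s powr (a / dW) * exp (- (c4 / 2) * z) *
          (z powr b * exp (- (c4 / 2) * z))"
      proof -
        have "exp (- c4 * z) = exp (- (c4 / 2) * z) * exp (- (c4 / 2) * z)"
          by (simp flip: exp_add)
        then show ?thesis by (simp add: da)
      qed
      also have "\<dots> \<le> c3 * s powr (- dH / dW) * s powr (a / dW) * exp (- (c4 / 2) * z) * A0"
        using c by (intro mult_left_mono A0 z) auto
      also have "\<dots> = A * s powr (a / dW) * (c5 * (\<Lambda> * s) powr (- dH / dW) * exp (- (c4 / 2) * z))"
      proof -
        have "(\<Lambda> * s) powr (- dH / dW) = \<Lambda> powr (- dH / dW) * s powr (- dH / dW)"
          using \<Lambda> s by (simp add: powr_mult)
        moreover have "A * c5 * \<Lambda> powr (- dH / dW) = c3 * A0"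
          using c \<Lambda> by (simp add: A_def)
        ultimately show ?thesis by (simp add: algebra_simps)
      qed
      also have "\<dots> \<le> A * s powr (a / dW) * pt (\<Lambda> * s) x y"
        using A lo unfolding z\<Lambda>[symmetric] d_def by (intro mult_left_mono) auto
      finally show "dist x y powr a * pt s x y \<le> A * s powr (a / dW) * pt (\<Lambda> * s) x y"
        by (simp add: d_def)
    qed
  qed
qed

section \<open>Differences of the heat semigroup\<close>

lemma indicator_L2:
  assumes "A \<in> sets \<mu>" "emeasure \<mu> A < \<infinity>"
  shows "indicator A \<in> Lp_space \<mu> 2"
proof -
  have "(\<lambda>x. (indicator A x :: real)\<^sup>2) = indicator A"
    by (auto split: split_indicator)
  then show ?thesis
    using assms by (simp add: Lp_space_2_iff)
qed

text \<open>Contractivity on bounded functions and positivity of the kernel place \<open>P s\<close>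
  of an indicator between 0 and 1; integrating over a second set gives the test required by
  \<open>kernel_mass_le_1\<close>.\<close>

lemma heat_kernel_mass:
  assumes sf: "sigma_finite_measure \<mu>"
    and P: "L2_semigroup_of_form \<mu> E F P" and ext: "extended_to_Lp \<mu> P" and hk: "heat_kernel \<mu> P pt"
    and s: "0 < s" and pos: "AE (x, y) in \<mu> \<Otimes>\<^sub>M \<mu>. 0 \<le> pt s x y"
  shows "AE x in \<mu>. (\<integral>\<^sup>+y. ennreal (pt s x y) \<partial>\<mu>) \<le> 1"
    and "AE y in \<mu>. (\<integral>\<^sup>+x. ennreal (pt s x y) \<partial>\<mu>) \<le> 1"
proof -
  interpret S: sigma_finite_measure \<mu> by fact
  interpret pair_sigma_finite \<mu> \<mu> ..
  have k[measurable]: "(\<lambda>(x, y). pt s x y) \<in> borel_measurable (\<mu> \<Otimes>\<^sub>M \<mu>)"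
    using hk s by (simp add: heat_kernel_def)
  have pos': "AE x in \<mu>. AE y in \<mu>. 0 \<le> pt s x y"
    using AE_pair[OF pos] by simp
  let ?I = "\<lambda>A. indicator A :: 'a \<Rightarrow> real"
  have *: "(\<integral>\<^sup>+x. (\<integral>\<^sup>+y. indicator A x * (indicator B y * ennreal (pt s x y)) \<partial>\<mu>) \<partial>\<mu>)
        = ennreal (L2_inner \<mu> (?I A) (P s (?I B))) \<and> ennreal (L2_inner \<mu> (?I A) (P s (?I B))) \<le> emeasure \<mu> A"
    if [measurable]: "A \<in> sets \<mu>" "B \<in> sets \<mu>" and fin: "emeasure \<mu> A < \<infinity>" "emeasure \<mu> B < \<infinity>" for A B
  proof -
    have A: "?I A \<in> Lp_space \<mu> 2" and B: "?I B \<in> Lp_space \<mu> 2"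
      by (rule indicator_L2; fact)+
    have PB: "P s (?I B) \<in> Lp_space \<mu> 2"
      using P s B by (simp add: L2_semigroup_of_form_def contraction_operator_def)
    then have [measurable]: "P s (?I B) \<in> borel_measurable \<mu>" by (simp add: Lp_space_2_iff)
    have rep: "AE x in \<mu>. integrable \<mu> (\<lambda>y. pt s x y * ?I B y) \<and> P s (?I B) x = (\<integral>y. pt s x y * ?I B y \<partial>\<mu>)"
      using hk s B by (simp add: heat_kernel_def)
    \<comment> \<open>The indicator is both square integrable and bounded, so the kernel
      representation and the supremum bound concern the same function
      \<open>P s (?I B)\<close>.\<close>
    have in_Linf: "?I B \<in> Linf_space \<mu>" "Linf_norm \<mu> (?I B) \<le> 1"
      by (auto intro!: Linf_normI[where K = 1] split: split_indicator)
    then have "P s (?I B) \<in> Linf_space \<mu>" "Linf_norm \<mu> (P s (?I B)) \<le> Linf_norm \<mu> (?I B)"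
      using ext s by (auto simp: extended_to_Lp_def contraction_operator_def)
    then have le1: "AE x in \<mu>. \<bar>P s (?I B) x\<bar> \<le> 1"
      using AE_abs_le_Linf_norm[of "P s (?I B)" \<mu>] in_Linf(2) by (auto elim!: eventually_mono)
    have nn: "AE x in \<mu>. 0 \<le> P s (?I B) x"
      using pos' rep
    proof eventually_elim
      case (elim x)
      then have "AE y in \<mu>. 0 \<le> pt s x y * ?I B y"
        by (auto elim!: eventually_mono)
      then show ?case using elim by (auto intro: integral_nonneg_AE)
    qed
    have "(\<integral>\<^sup>+x. (\<integral>\<^sup>+y. indicator A x * (indicator B y * ennreal (pt s x y)) \<partial>\<mu>) \<partial>\<mu>)
        = (\<integral>\<^sup>+x. ennreal (?I A x * P s (?I B) x) \<partial>\<mu>)"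
    proof (rule nn_integral_cong_AE)
      show "AE x in \<mu>. (\<integral>\<^sup>+y. indicator A x * (indicator B y * ennreal (pt s x y)) \<partial>\<mu>)
          = ennreal (?I A x * P s (?I B) x)"
        using pos' rep AE_space
      proof eventually_elim
        case (elim x)
        then have "AE y in \<mu>. 0 \<le> pt s x y * ?I B y"
          by (auto elim!: eventually_mono)
        then have "(\<integral>\<^sup>+y. ennreal (pt s x y * ?I B y) \<partial>\<mu>) = ennreal (P s (?I B) x)"
          using elim nn_integral_eq_integral[of \<mu> "\<lambda>y. pt s x y * ?I B y"] by simp
        moreover have "(\<integral>\<^sup>+y. indicator B y * ennreal (pt s x y) \<partial>\<mu>) = (\<integral>\<^sup>+y. ennreal (pt s x y * ?I B y) \<partial>\<mu>)"
          by (intro nn_integral_cong) (auto split: split_indicator)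
        ultimately show ?case
          by (auto split: split_indicator)
      qed
    qed
    also have "\<dots> = ennreal (L2_inner \<mu> (?I A) (P s (?I B)))"
      unfolding L2_inner_def using nn
      by (intro nn_integral_eq_integral L2_integrable_mult A PB) (auto elim!: eventually_mono)
    finally have eq: "(\<integral>\<^sup>+x. (\<integral>\<^sup>+y. indicator A x * (indicator B y * ennreal (pt s x y)) \<partial>\<mu>) \<partial>\<mu>)
        = ennreal (L2_inner \<mu> (?I A) (P s (?I B)))" .
    have "ennreal (L2_inner \<mu> (?I A) (P s (?I B))) = (\<integral>\<^sup>+x. ennreal (?I A x * P s (?I B) x) \<partial>\<mu>)"
      unfolding L2_inner_def using nn
      by (intro nn_integral_eq_integral[symmetric] L2_integrable_mult A PB) (auto elim!: eventually_mono)
    also have "\<dots> \<le> (\<integral>\<^sup>+x. indicator A x \<partial>\<mu>)"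
      using le1 by (intro nn_integral_mono_AE) (auto elim!: eventually_mono split: split_indicator)
    finally show ?thesis using eq by simp
  qed
  show "AE x in \<mu>. (\<integral>\<^sup>+y. ennreal (pt s x y) \<partial>\<mu>) \<le> 1"
    using * by (intro S.kernel_mass_le_1[of "\<lambda>x y. ennreal (pt s x y)"]) auto
  \<comment> \<open>Columns are rows of the transposed kernel: Tonelli exchanges the integrals, and
    symmetry of \<open>P s\<close> exchanges the two indicators.\<close>
  show "AE y in \<mu>. (\<integral>\<^sup>+x. ennreal (pt s x y) \<partial>\<mu>) \<le> 1"
  proof (rule S.kernel_mass_le_1[of "\<lambda>y x. ennreal (pt s x y)"])
    show "(\<lambda>(y, x). ennreal (pt s x y)) \<in> borel_measurable (\<mu> \<Otimes>\<^sub>M \<mu>)"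
      using measurable_pair_swap[OF k] by (simp add: case_prod_beta)
    fix A B assume AB[measurable]: "A \<in> sets \<mu>" "B \<in> sets \<mu>" and fin: "emeasure \<mu> A < \<infinity>" "emeasure \<mu> B < \<infinity>"
    have "(\<integral>\<^sup>+y. (\<integral>\<^sup>+x. indicator A y * (indicator B x * ennreal (pt s x y)) \<partial>\<mu>) \<partial>\<mu>)
        = (\<integral>\<^sup>+x. (\<integral>\<^sup>+y. indicator A y * (indicator B x * ennreal (pt s x y)) \<partial>\<mu>) \<partial>\<mu>)"
      by (rule Fubini') measurable
    also have "\<dots> = ennreal (L2_inner \<mu> (?I B) (P s (?I A)))"
      using *[OF AB(2,1) fin(2,1)] by (simp add: mult.left_commute)
    also have "L2_inner \<mu> (?I B) (P s (?I A)) = L2_inner \<mu> (P s (?I B)) (?I A)"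
      using P s indicator_L2[OF AB(1) fin(1)] indicator_L2[OF AB(2) fin(2)]
      unfolding L2_semigroup_of_form_def by simp
    also have "\<dots> = L2_inner \<mu> (?I A) (P s (?I B))"
      by (rule L2_inner_commute)
    also have "ennreal \<dots> \<le> emeasure \<mu> A"
      using *[OF AB fin] by simp
    finally show "(\<integral>\<^sup>+y. (\<integral>\<^sup>+x. indicator A y * (indicator B x * ennreal (pt s x y)) \<partial>\<mu>) \<partial>\<mu>) \<le> emeasure \<mu> A" .
  qed
qed

text \<open>The L2 endpoint: \<open>kernel_energy_le\<close> for the function \<open>P t f\<close>
  and the kernel at time \<open>s\<close>, followed by the energy decay. Each contributes a factor
  2.\<close>

lemma heat_semigroup_energy_le:
  assumes sf: "sigma_finite_measure \<mu>"
    and P: "L2_semigroup_of_form \<mu> E F P" and ext: "extended_to_Lp \<mu> P" and hk: "heat_kernel \<mu> P pt"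
    and s: "0 < s" and pos: "AE (x, y) in \<mu> \<Otimes>\<^sub>M \<mu>. 0 \<le> pt s x y"
    and t: "0 < t" and f: "f \<in> Lp_space \<mu> 2"
  shows "(\<integral>\<^sup>+(x, y). ennreal ((P t f x - P t f y)\<^sup>2 * pt s x y) \<partial>(\<mu> \<Otimes>\<^sub>M \<mu>))
    \<le> ennreal (4 * (s / t) * L2_inner \<mu> f f)"
proof -
  interpret sigma_finite_measure \<mu> by fact
  have L2: "P r g \<in> Lp_space \<mu> 2" if "0 < r" "g \<in> Lp_space \<mu> 2" for r g
    using P that by (simp add: L2_semigroup_of_form_def contraction_operator_def)
  have "(\<integral>\<^sup>+(x, y). ennreal ((P t f x - P t f y)\<^sup>2 * pt s x y) \<partial>(\<mu> \<Otimes>\<^sub>M \<mu>))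
      \<le> ennreal (2 * (L2_inner \<mu> (P t f) (P t f) - L2_inner \<mu> (P s (P t f)) (P t f)))"
  proof (rule kernel_energy_le)
    show "(\<lambda>(x, y). pt s x y) \<in> borel_measurable (\<mu> \<Otimes>\<^sub>M \<mu>)"
      using hk s by (simp add: heat_kernel_def)
    show "P t f \<in> Lp_space \<mu> 2" by (intro L2 t f)
    then show "P s (P t f) \<in> borel_measurable \<mu>"
      using L2[OF s, of "P t f"] by (simp add: Lp_space_2_iff)
    show "AE x in \<mu>. P s (P t f) x = (\<integral>y. pt s x y * P t f y \<partial>\<mu>)"
      using hk s L2[OF t f] by (auto simp: heat_kernel_def elim!: eventually_mono)
  qed (use heat_kernel_mass[OF sf P ext hk s pos] pos in auto)
  also have "\<dots> \<le> ennreal (4 * (s / t) * L2_inner \<mu> f f)"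
    using L2_semigroup_energy_decay[OF P f s t] by (intro ennreal_leI) simp
  finally show ?thesis .
qed

text \<open>Where \<open>c < \<bar>f x\<bar>\<close>, the square of \<open>f\<close> is at most
  \<open>c powr (2 - p) * \<bar>f x\<bar> powr p\<close> because 2 - p \<le> 0, so the large part is
  square integrable. The last identity has the shape of the right-hand side in
  \<open>weak_type_interpolation\<close>.\<close>

lemma Lp_truncation:
  fixes f :: "'a \<Rightarrow> real"
  assumes f: "f \<in> Lp_space \<mu> p" and p: "2 \<le> p" and c: "0 < c"
  defines "b \<equiv> \<lambda>x. f x * indicator {x. c < \<bar>f x\<bar>} x"
    and "h \<equiv> \<lambda>x. f x * indicator {x. \<bar>f x\<bar> \<le> c} x"
  shows "b \<in> Lp_space \<mu> p" and "b \<in> Lp_space \<mu> 2" and "h \<in> Lp_space \<mu> p"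
    and "h \<in> Linf_space \<mu>" and "Linf_norm \<mu> h \<le> c"
    and "ennreal (L2_inner \<mu> b b) = (\<integral>\<^sup>+x. ennreal ((f x)\<^sup>2) * indicator {x. c < \<bar>f x\<bar>} x \<partial>\<mu>)"
proof -
  have [measurable]: "f \<in> borel_measurable \<mu>" and int: "integrable \<mu> (\<lambda>x. \<bar>f x\<bar> powr p)"
    using f by (auto simp: Lp_space_def)
  have [measurable]: "b \<in> borel_measurable \<mu>" "h \<in> borel_measurable \<mu>"
    unfolding b_def h_def by measurable
  have "integrable \<mu> (\<lambda>x. \<bar>b x\<bar> powr p)"
    by (rule Bochner_Integration.integrable_bound[OF int])
      (auto simp: b_def split: split_indicator)
  then show "b \<in> Lp_space \<mu> p" by (simp add: Lp_space_def)
  have "integrable \<mu> (\<lambda>x. \<bar>h x\<bar> powr p)"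
    by (rule Bochner_Integration.integrable_bound[OF int])
      (auto simp: h_def split: split_indicator)
  then show "h \<in> Lp_space \<mu> p" by (simp add: Lp_space_def)
  have "integrable \<mu> (\<lambda>x. (b x)\<^sup>2)"
  proof (rule Bochner_Integration.integrable_bound)
    show "integrable \<mu> (\<lambda>x. c powr (2 - p) * \<bar>f x\<bar> powr p)"
      using int by simp
    show "AE x in \<mu>. norm ((b x)\<^sup>2) \<le> norm (c powr (2 - p) * \<bar>f x\<bar> powr p)"
    proof (rule AE_I2)
      fix x
      have "(f x)\<^sup>2 \<le> c powr (2 - p) * \<bar>f x\<bar> powr p" if "c < \<bar>f x\<bar>"
      proof -
        have "(f x)\<^sup>2 = \<bar>f x\<bar> powr (2 - p) * \<bar>f x\<bar> powr p"
          unfolding powr_add[symmetric] by (simp add: abs_powr_two)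
        also have "\<dots> \<le> c powr (2 - p) * \<bar>f x\<bar> powr p"
          using that c p by (intro mult_right_mono powr_mono2') auto
        finally show ?thesis .
      qed
      then show "norm ((b x)\<^sup>2) \<le> norm (c powr (2 - p) * \<bar>f x\<bar> powr p)"
        by (auto simp: b_def split: split_indicator)
    qed
  qed measurable
  then show "b \<in> Lp_space \<mu> 2" by (simp add: Lp_space_2_iff)
  from L2_nn_integral[OF this]
  have "ennreal (L2_inner \<mu> b b) = (\<integral>\<^sup>+x. ennreal ((b x)\<^sup>2) \<partial>\<mu>)" by simp
  also have "\<dots> = (\<integral>\<^sup>+x. ennreal ((f x)\<^sup>2) * indicator {x. c < \<bar>f x\<bar>} x \<partial>\<mu>)"
    by (intro nn_integral_cong) (auto simp: b_def split: split_indicator)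
  finally show "ennreal (L2_inner \<mu> b b) = (\<integral>\<^sup>+x. ennreal ((f x)\<^sup>2) * indicator {x. c < \<bar>f x\<bar>} x \<partial>\<mu>)" .
  show "h \<in> Linf_space \<mu>" "Linf_norm \<mu> h \<le> c"
    using c by (auto intro!: Linf_normI simp: h_def split: split_indicator)
qed

text \<open>
  Split \<open>f\<close> at height \<open>l / (2 * C)\<close>: the Bakry-Emery estimate bounds the contribution of the small
  part by \<open>l / 2 * dist x y powr \<kappa>\<close>, and the energy estimate applies to the large part.
\<close>

lemma weak_type_heat_difference:
  fixes \<mu> :: "'a::metric_space measure"
  assumes sf: "sigma_finite_measure \<mu>"
    and P: "L2_semigroup_of_form \<mu> E F P" and ext: "extended_to_Lp \<mu> P" and hk: "heat_kernel \<mu> P pt"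
    and s: "0 < s" and pos: "AE (x, y) in \<mu> \<Otimes>\<^sub>M \<mu>. 0 \<le> pt s x y"
    and t: "0 < t" and p: "2 \<le> p" and f: "f \<in> Lp_space \<mu> p" and C: "0 < C"
    and BE: "\<And>g. g \<in> Linf_space \<mu> \<Longrightarrow> \<exists>h. (AE x in \<mu>. P t g x = h x) \<and>
        (\<forall>x y. \<bar>h x - h y\<bar> \<le> C * dist x y powr \<kappa> * Linf_norm \<mu> g)"
    and l: "0 < l"
  shows "(\<integral>\<^sup>+z. ennreal ((dist (fst z) (snd z) powr \<kappa>)\<^sup>2 * pt s (fst z) (snd z)) *
        indicator {z. l < \<bar>P t f (fst z) - P t f (snd z)\<bar> / dist (fst z) (snd z) powr \<kappa>} z \<partial>(\<mu> \<Otimes>\<^sub>M \<mu>))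
    \<le> ennreal (16 * (s / t) / l\<^sup>2) *
        (\<integral>\<^sup>+x. ennreal ((f x)\<^sup>2) * indicator {x. 1 / (2 * C) * l < \<bar>f x\<bar>} x \<partial>\<mu>)"
proof -
  interpret sigma_finite_measure \<mu> by fact
  interpret pair_sigma_finite \<mu> \<mu> ..
  define c where "c = 1 / (2 * C) * l"
  have c: "0 < c" using C l by (simp add: c_def)
  define b where "b = (\<lambda>x. f x * indicator {x. c < \<bar>f x\<bar>} x)"
  define h where "h = (\<lambda>x. f x * indicator {x. \<bar>f x\<bar> \<le> c} x)"
  note trunc = Lp_truncation[OF f p c, folded b_def h_def]
  have f_eq: "f = (\<lambda>x. 1 * b x + 1 * h x)"
    by (auto simp: b_def h_def split: split_indicator)
  have "linear_AE \<mu> (Lp_space \<mu> p) (P t)"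
    using ext t p by (simp add: extended_to_Lp_def contraction_operator_def)
  then have "AE x in \<mu>. P t (\<lambda>x. 1 * b x + 1 * h x) x = 1 * P t b x + 1 * P t h x"
    using trunc(1,3) unfolding linear_AE_def by blast
  then have lin: "AE x in \<mu>. P t f x = P t b x + P t h x"
    unfolding f_eq[symmetric] by simp
  obtain H where H: "AE x in \<mu>. P t h x = H x"
      "\<And>x y. \<bar>H x - H y\<bar> \<le> C * dist x y powr \<kappa> * Linf_norm \<mu> h"
    using BE[OF trunc(4)] by blast
  have Hle: "\<bar>H x - H y\<bar> \<le> l / 2 * dist x y powr \<kappa>" for x y
  proof -
    have "C * dist x y powr \<kappa> * Linf_norm \<mu> h \<le> C * dist x y powr \<kappa> * c"
      using C trunc(5) by (intro mult_left_mono) auto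
    then show ?thesis using H(2)[of x y] C by (simp add: c_def field_simps)
  qed
  have [measurable]: "(\<lambda>(x, y). pt s x y) \<in> borel_measurable (\<mu> \<Otimes>\<^sub>M \<mu>)"
    using hk s by (simp add: heat_kernel_def)
  have [measurable]: "P t b \<in> borel_measurable \<mu>"
    using P t trunc(2) by (auto simp: L2_semigroup_of_form_def contraction_operator_def Lp_space_2_iff)
  let ?d = "\<lambda>z :: 'a \<times> 'a. dist (fst z) (snd z) powr \<kappa>"
  have "(\<integral>\<^sup>+z. ennreal ((?d z)\<^sup>2 * pt s (fst z) (snd z)) *
        indicator {z. l < \<bar>P t f (fst z) - P t f (snd z)\<bar> / ?d z} z \<partial>(\<mu> \<Otimes>\<^sub>M \<mu>))
      \<le> (\<integral>\<^sup>+z. ennreal (4 / l\<^sup>2) * (case z of (x, y) \<Rightarrow> ennreal ((P t b x - P t b y)\<^sup>2 * pt s x y)) \<partial>(\<mu> \<Otimes>\<^sub>M \<mu>))"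
  proof (rule nn_integral_mono_AE)
    \<comment> \<open>The splitting and the version \<open>H\<close> are known only almost
      everywhere in one variable; \<open>AE_fst\<close> and \<open>AE_snd\<close> carry them over to
      pairs.\<close>
    show "AE z in \<mu> \<Otimes>\<^sub>M \<mu>. ennreal ((?d z)\<^sup>2 * pt s (fst z) (snd z)) *
        indicator {z. l < \<bar>P t f (fst z) - P t f (snd z)\<bar> / ?d z} z
        \<le> ennreal (4 / l\<^sup>2) * (case z of (x, y) \<Rightarrow> ennreal ((P t b x - P t b y)\<^sup>2 * pt s x y))"
      using AE_fst[OF lin] AE_snd[OF lin] AE_fst[OF H(1)] AE_snd[OF H(1)] pos
    proof eventually_elim
      case (elim z)
      obtain x y where z: "z = (x, y)" by (cases z)
      let ?D = "dist x y powr \<kappa>"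
      have pt0: "0 \<le> pt s x y" using elim z by simp
      show ?case
      proof (cases "l < \<bar>P t f x - P t f y\<bar> / ?D")
        case True
        \<comment> \<open>Division by 0 yields 0, so pairs at distance 0 never satisfy the level
          condition.\<close>
        have "?D \<noteq> 0"
        proof
          assume "?D = 0"
          then show False using True l by simp
        qed
        then have D: "0 < ?D" by (simp add: less_le)
        have "l * ?D < \<bar>P t f x - P t f y\<bar>"
          using True D by (simp add: field_simps)
        moreover have "P t f x - P t f y = (P t b x - P t b y) + (H x - H y)"
          using elim z by simp
        \<comment> \<open>The bounded part accounts for at most half of \<open>l * ?D\<close>, so
          the large part carries the rest; squaring gives the Chebyshev factor
          \<open>4 / l\<^sup>2\<close>.\<close>
        ultimately have "l * ?D / 2 \<le> \<bar>P t b x - P t b y\<bar>"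
          using Hle[of x y] by linarith
        then have "(l * ?D / 2)\<^sup>2 \<le> \<bar>P t b x - P t b y\<bar>\<^sup>2"
          using l D by (intro power_mono) auto
        then have "?D\<^sup>2 \<le> 4 / l\<^sup>2 * (P t b x - P t b y)\<^sup>2"
          using l by (simp add: field_simps power_mult_distrib power_divide)
        then have "?D\<^sup>2 * pt s x y \<le> 4 / l\<^sup>2 * (P t b x - P t b y)\<^sup>2 * pt s x y"
          using pt0 by (rule mult_right_mono)
        then show ?thesis
          using True by (simp add: z mult.assoc ennreal_leI flip: ennreal_mult')
      qed (simp add: z)
    qed
  qed
  also have "\<dots> = ennreal (4 / l\<^sup>2) * (\<integral>\<^sup>+(x, y). ennreal ((P t b x - P t b y)\<^sup>2 * pt s x y) \<partial>(\<mu> \<Otimes>\<^sub>M \<mu>))"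
    by (rule nn_integral_cmult) measurable
  also have "\<dots> \<le> ennreal (4 / l\<^sup>2) * ennreal (4 * (s / t) * L2_inner \<mu> b b)"
    by (intro mult_left_mono heat_semigroup_energy_le[OF sf P ext hk s pos t trunc(2)]) simp
  also have "\<dots> = ennreal (16 * (s / t) / l\<^sup>2) * ennreal (L2_inner \<mu> b b)"
    using s t by (subst (1 2) ennreal_mult'[symmetric]) (auto simp: mult_ac)
  finally show ?thesis
    unfolding trunc(6) c_def .
qed

text \<open>The powers of time have three sources: \<open>s / t\<close> from the energy,
  \<open>s powr ((p - 2) * \<kappa> / dW)\<close> from absorbing the surplus power of the distance,
  and the same power of \<open>1 / t\<close> from the Bakry-Emery constant.\<close>

lemma heat_semigroup_Lp_difference:
  fixes \<mu> :: "'a::metric_space measure"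
  assumes mms: "metric_measure_space \<mu>"
    and sf: "sigma_finite_measure \<mu>"
    and P: "L2_semigroup_of_form \<mu> E F P" and ext: "extended_to_Lp \<mu> P" and hk: "heat_kernel \<mu> P pt"
    and sG: "sub_Gaussian \<mu> pt dH dW" and BE: "weak_Bakry_Emery \<mu> P dW \<kappa>"
    and \<kappa>: "0 < \<kappa>" and p: "2 \<le> p"
  obtains K where "0 < K"
    "\<And>s t f. 0 < s \<Longrightarrow> 0 < t \<Longrightarrow> f \<in> Lp_space \<mu> p \<Longrightarrow>
      (\<integral>\<^sup>+(x, y). ennreal (\<bar>P t f x - P t f y\<bar> powr p * pt s x y) \<partial>(\<mu> \<Otimes>\<^sub>M \<mu>))
        \<le> ennreal (K * (s / t) powr ((p - 2) * \<kappa> / dW + 1) * (\<integral>x. \<bar>f x\<bar> powr p \<partial>\<mu>))"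
proof -
  interpret sigma_finite_measure \<mu> by fact
  interpret pair_sigma_finite \<mu> \<mu> ..
  \<comment> \<open>The lower sub-Gaussian bound is itself nonnegative.\<close>
  have pos: "AE (x, y) in \<mu> \<Otimes>\<^sub>M \<mu>. 0 \<le> pt s x y" if s: "0 < s" for s
  proof -
    obtain c3 c4 c5 c6 where "0 < c5" and "AE (x, y) in \<mu> \<Otimes>\<^sub>M \<mu>.
        c5 * s powr (- dH / dW) * exp (- c6 * (dist x y powr dW / s) powr (1 / (dW - 1))) \<le> pt s x y \<and>
        pt s x y \<le> c3 * s powr (- dH / dW) * exp (- c4 * (dist x y powr dW / s) powr (1 / (dW - 1)))"
      using sG s unfolding sub_Gaussian_def by blast
    then show ?thesis
      by (auto elim!: eventually_mono intro: order_trans[rotated])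
  qed
  have pt_meas: "(\<lambda>(x, y). pt s x y) \<in> borel_measurable (\<mu> \<Otimes>\<^sub>M \<mu>)" if "0 < s" for s
    using hk that by (simp add: heat_kernel_def)
  show thesis
  \<comment> \<open>The interpolation constant contains \<open>1 / (p - 2)\<close>, so p = 2 is
    separate; there the energy estimate is already the claim.\<close>
  proof (cases "p = 2")
    case True
    show thesis
    proof (rule that[of 4])
      fix s t :: real and f :: "'a \<Rightarrow> real" assume s: "0 < s" and t: "0 < t" and f: "f \<in> Lp_space \<mu> p"
      have "L2_inner \<mu> f f = (\<integral>x. \<bar>f x\<bar> powr p \<partial>\<mu>)"
        unfolding True L2_inner_def by (simp add: abs_powr_two power2_eq_square del: powr_numeral)
      then show "(\<integral>\<^sup>+(x, y). ennreal (\<bar>P t f x - P t f y\<bar> powr p * pt s x y) \<partial>(\<mu> \<Otimes>\<^sub>M \<mu>))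
        \<le> ennreal (4 * (s / t) powr ((p - 2) * \<kappa> / dW + 1) * (\<integral>x. \<bar>f x\<bar> powr p \<partial>\<mu>))"
        using heat_semigroup_energy_le[OF sf P ext hk s pos[OF s] t f[unfolded True]] s t
        unfolding True by (simp add: abs_powr_two del: powr_numeral)
    qed simp
  next
    case False
    then have p2: "2 < p" using p by simp
    define a where "a = (p - 2) * \<kappa>"
    have a: "0 \<le> a" using p2 \<kappa> by (simp add: a_def)
    obtain \<Lambda> A where \<Lambda>: "0 < \<Lambda>" and A: "0 < A" and weight: "\<And>s. 0 < s \<Longrightarrow>
        AE (x, y) in \<mu> \<Otimes>\<^sub>M \<mu>. dist x y powr a * pt s x y \<le> A * s powr (a / dW) * pt (\<Lambda> * s) x y"
      using sub_Gaussian_weight[OF sG a] by blast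
    obtain C where C: "0 < C" and BE': "\<And>t g. 0 < t \<Longrightarrow> g \<in> Linf_space \<mu> \<Longrightarrow>
        \<exists>h. (AE x in \<mu>. P t g x = h x) \<and>
          (\<forall>x y. \<bar>h x - h y\<bar> \<le> C * (dist x y powr \<kappa> / t powr (\<kappa> / dW)) * Linf_norm \<mu> g)"
      using BE unfolding weak_Bakry_Emery_def by blast
    \<comment> \<open>\<open>A\<close> comes from the time change, 16 and \<open>\<Lambda>\<close>
      from the weak-type bound at time \<open>\<Lambda> * s\<close>, and the rest from interpolating
      with a threshold proportional to \<open>1 / (2 * C)\<close>.\<close>
    define K where "K = A * (p * (16 * \<Lambda>) / (p - 2)) * (2 * C) powr (p - 2)"
    have dist_meas[measurable]: "(\<lambda>z. dist (fst z) (snd z)) \<in> borel_measurable (\<mu> \<Otimes>\<^sub>M \<mu>)"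
      using mms by (intro borel_measurable_dist_pair) (auto simp: metric_measure_space_def)
    show thesis
    proof (rule that[of K])
      show "0 < K" using A \<Lambda> C p2 by (simp add: K_def)
      fix s t :: real and f :: "'a \<Rightarrow> real" assume s: "0 < s" and t: "0 < t" and f: "f \<in> Lp_space \<mu> p"
      have \<Lambda>s: "0 < \<Lambda> * s" using \<Lambda> s by simp
      note [measurable] = pt_meas[OF s] pt_meas[OF \<Lambda>s]
      define N where "N = (\<integral>x. \<bar>f x\<bar> powr p \<partial>\<mu>)"
      \<comment> \<open>For fixed \<open>t\<close> the Bakry-Emery constant is \<open>C / T\<close>,
        and its power \<open>p - 2\<close> supplies the negative power of \<open>t\<close>.\<close>
      define T where "T = t powr (\<kappa> / dW)"
      have T: "0 < T" using t by (simp add: T_def)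
      have [measurable]: "f \<in> borel_measurable \<mu>" and int: "integrable \<mu> (\<lambda>x. \<bar>f x\<bar> powr p)"
        using f by (auto simp: Lp_space_def)
      have [measurable]: "P t f \<in> borel_measurable \<mu>"
      proof -
        have "P t f \<in> Lp_space \<mu> p"
          using ext t p f by (simp add: extended_to_Lp_def contraction_operator_def)
        then show ?thesis by (simp add: Lp_space_def)
      qed
      let ?d = "\<lambda>z :: 'a \<times> 'a. dist (fst z) (snd z) powr \<kappa>"
      let ?u = "\<lambda>z. \<bar>P t f (fst z) - P t f (snd z)\<bar> / ?d z"
      \<comment> \<open>The weight already carries the kernel at time \<open>\<Lambda> * s\<close>,
        the one left after the surplus power of the distance has been absorbed.\<close>
      let ?w = "\<lambda>z. ennreal ((?d z)\<^sup>2 * pt (\<Lambda> * s) (fst z) (snd z))"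
      have "(\<integral>\<^sup>+z. ?w z * ennreal (?u z powr p) \<partial>(\<mu> \<Otimes>\<^sub>M \<mu>))
          \<le> ennreal (p * (16 * (\<Lambda> * s / t)) / ((p - 2) * (1 / (2 * (C / T))) powr (p - 2)) *
            (\<integral>x. \<bar>f x\<bar> powr p \<partial>\<mu>))"
      proof (rule weak_type_interpolation[OF _ sf _ _ _ _ p2 _ _ int])
        show "sigma_finite_measure (\<mu> \<Otimes>\<^sub>M \<mu>)" by unfold_locales
        fix l :: real assume l: "0 < l"
        show "(\<integral>\<^sup>+z. ?w z * indicator {z. l < ?u z} z \<partial>(\<mu> \<Otimes>\<^sub>M \<mu>))
          \<le> ennreal (16 * (\<Lambda> * s / t) / l\<^sup>2) *
            (\<integral>\<^sup>+x. ennreal ((f x)\<^sup>2) * indicator {x. 1 / (2 * (C / T)) * l < \<bar>f x\<bar>} x \<partial>\<mu>)"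
        proof (rule weak_type_heat_difference[OF sf P ext hk \<Lambda>s pos[OF \<Lambda>s] t p f _ _ l])
          show "0 < C / T" using C T by simp
          show "\<exists>h. (AE x in \<mu>. P t g x = h x) \<and>
              (\<forall>x y. \<bar>h x - h y\<bar> \<le> C / T * dist x y powr \<kappa> * Linf_norm \<mu> g)"
            if "g \<in> Linf_space \<mu>" for g
            using BE'[OF t that] by (simp add: T_def)
        qed
      qed (use C T \<Lambda>s t in auto)
      also have "p * (16 * (\<Lambda> * s / t)) / ((p - 2) * (1 / (2 * (C / T))) powr (p - 2))
          = p * (16 * \<Lambda>) / (p - 2) * (2 * C) powr (p - 2) * ((s / t) / t powr (a / dW))"
      proof -
        have "(1 / (2 * (C / T))) powr (p - 2) = T powr (p - 2) / (2 * C) powr (p - 2)"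
          using C T by (simp add: powr_divide)
        moreover have "T powr (p - 2) = t powr (a / dW)"
          by (simp add: T_def a_def powr_powr mult.commute)
        ultimately show ?thesis by (simp add: mult_ac)
      qed
      finally have weighted: "(\<integral>\<^sup>+z. ?w z * ennreal (?u z powr p) \<partial>(\<mu> \<Otimes>\<^sub>M \<mu>))
          \<le> ennreal (p * (16 * \<Lambda>) / (p - 2) * (2 * C) powr (p - 2) * ((s / t) / t powr (a / dW)) * N)"
        by (simp add: N_def)
      have "(\<integral>\<^sup>+(x, y). ennreal (\<bar>P t f x - P t f y\<bar> powr p * pt s x y) \<partial>(\<mu> \<Otimes>\<^sub>M \<mu>))
          \<le> (\<integral>\<^sup>+z. ennreal (A * s powr (a / dW)) * (?w z * ennreal (?u z powr p)) \<partial>(\<mu> \<Otimes>\<^sub>M \<mu>))"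
      proof (rule nn_integral_mono_AE)
        show "AE z in \<mu> \<Otimes>\<^sub>M \<mu>. (case z of (x, y) \<Rightarrow> ennreal (\<bar>P t f x - P t f y\<bar> powr p * pt s x y))
          \<le> ennreal (A * s powr (a / dW)) * (?w z * ennreal (?u z powr p))"
          using weight[OF s] pos[OF \<Lambda>s]
        proof eventually_elim
          case (elim z)
          obtain x y where z: "z = (x, y)" by (cases z)
          \<comment> \<open>On the diagonal the difference is 0; off it the distance is positive and
            its powers can be cancelled.\<close>
          show ?case
          proof (cases "x = y")
            case True
            then show ?thesis by (simp add: z)
          next
            case False
            define D where "D = dist x y"
            have D: "0 < D" using False by (simp add: D_def)
            define U where "U = \<bar>P t f x - P t f y\<bar> / D powr \<kappa>"
            have U: "0 \<le> U" by (simp add: U_def)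
            have "\<bar>P t f x - P t f y\<bar> = D powr \<kappa> * U"
              using D by (simp add: U_def)
            then have "\<bar>P t f x - P t f y\<bar> powr p = D powr (\<kappa> * p) * U powr p"
              using U by (simp add: powr_mult powr_powr)
            \<comment> \<open>Of the exponent \<open>\<kappa> * p\<close>, the part
              \<open>2 * \<kappa>\<close> stays in the weight and the surplus \<open>a\<close> goes
              into the time change.\<close>
            also have "D powr (\<kappa> * p) = (D powr \<kappa>)\<^sup>2 * D powr a"
            proof -
              have "(D powr \<kappa>)\<^sup>2 = D powr (\<kappa> + \<kappa>)"
                unfolding powr_add by (simp add: power2_eq_square)
              then show ?thesis
                unfolding a_def by (simp add: algebra_simps flip: powr_add)
            qed
            finally have "\<bar>P t f x - P t f y\<bar> powr p * pt s x y = (D powr \<kappa>)\<^sup>2 * U powr p * (D powr a * pt s x y)"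
              by simp
            also have "\<dots> \<le> (D powr \<kappa>)\<^sup>2 * U powr p * (A * s powr (a / dW) * pt (\<Lambda> * s) x y)"
              using elim(1) by (intro mult_left_mono) (auto simp: z D_def)
            also have "\<dots> = A * s powr (a / dW) * ((D powr \<kappa>)\<^sup>2 * pt (\<Lambda> * s) x y * U powr p)"
              by simp
            finally have le: "\<bar>P t f x - P t f y\<bar> powr p * pt s x y
                \<le> A * s powr (a / dW) * ((D powr \<kappa>)\<^sup>2 * pt (\<Lambda> * s) x y * U powr p)" .
            have "ennreal (A * s powr (a / dW)) * (ennreal ((D powr \<kappa>)\<^sup>2 * pt (\<Lambda> * s) x y) * ennreal (U powr p))
                = ennreal (A * s powr (a / dW) * ((D powr \<kappa>)\<^sup>2 * pt (\<Lambda> * s) x y * U powr p))"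
              using A elim(2) by (simp add: z ennreal_mult)
            then show ?thesis
              using ennreal_leI[OF le] by (simp add: z D_def U_def)
          qed
        qed
      qed
      also have "\<dots> = ennreal (A * s powr (a / dW)) * (\<integral>\<^sup>+z. ?w z * ennreal (?u z powr p) \<partial>(\<mu> \<Otimes>\<^sub>M \<mu>))"
        by (rule nn_integral_cmult) measurable
      also have "\<dots> \<le> ennreal (A * s powr (a / dW)) *
          ennreal (p * (16 * \<Lambda>) / (p - 2) * (2 * C) powr (p - 2) * ((s / t) / t powr (a / dW)) * N)"
        by (intro mult_left_mono weighted) simp
      also have "\<dots> = ennreal (A * s powr (a / dW) *
          (p * (16 * \<Lambda>) / (p - 2) * (2 * C) powr (p - 2) * ((s / t) / t powr (a / dW)) * N))"
        using A by (intro ennreal_mult'[symmetric]) simp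
      also have "A * s powr (a / dW) *
          (p * (16 * \<Lambda>) / (p - 2) * (2 * C) powr (p - 2) * ((s / t) / t powr (a / dW)) * N)
          = K * (s / t) powr (a / dW + 1) * N"
      proof -
        have "(s / t) powr (a / dW + 1) = s powr (a / dW) / t powr (a / dW) * (s / t)"
          using s t by (simp add: powr_add powr_divide)
        then show ?thesis by (simp add: K_def mult_ac)
      qed
      finally show "(\<integral>\<^sup>+(x, y). ennreal (\<bar>P t f x - P t f y\<bar> powr p * pt s x y) \<partial>(\<mu> \<Otimes>\<^sub>M \<mu>))
        \<le> ennreal (K * (s / t) powr ((p - 2) * \<kappa> / dW + 1) * (\<integral>x. \<bar>f x\<bar> powr p \<partial>\<mu>))"
        by (simp add: a_def N_def)
    qed
  qed
qed

section \<open>From the difference estimate to the Besov seminorm\<close>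

lemma ennreal_powr_le:
  assumes "a \<le> ennreal r" "0 \<le> r" "0 \<le> q"
  shows "ennreal_powr a q \<le> ennreal (r powr q)"
proof -
  have "a \<noteq> \<top>" using assms(1) by (rule neq_top_trans[OF ennreal_neq_top])
  moreover have "enn2real a \<le> r" using assms by (simp add: enn2real_leI)
  ultimately show ?thesis
    using assms(3) by (auto simp: ennreal_powr_def intro!: ennreal_leI powr_mono2)
qed

theorem theorem0p18:
  fixes \<mu> :: "'a::metric_space measure"
    and E :: "('a \<Rightarrow> real) \<Rightarrow> ('a \<Rightarrow> real) \<Rightarrow> real"
    and F :: "('a \<Rightarrow> real) set"
    and P :: "real \<Rightarrow> ('a \<Rightarrow> real) \<Rightarrow> ('a \<Rightarrow> real)"
    and pt :: "real \<Rightarrow> 'a \<Rightarrow> 'a \<Rightarrow> real"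
    and d\<^sub>H d\<^sub>W \<kappa> p :: real
  assumes "metric_measure_space \<mu>"
    and "dirichlet_form \<mu> E F"
    and "regular_form \<mu> E F"
    and "strongly_local_form \<mu> E F"
    and "L2_semigroup_of_form \<mu> E F P"
    and "extended_to_Lp \<mu> P"
    and "conservative \<mu> P"
    and "Ahlfors_regular \<mu> d\<^sub>H"
    and "heat_kernel \<mu> P pt"
    and "sub_Gaussian \<mu> pt d\<^sub>H d\<^sub>W"
    and "weak_Bakry_Emery \<mu> P d\<^sub>W \<kappa>"
    and "0 < \<kappa>" and "\<kappa> \<le> d\<^sub>W / 2"
    and "2 \<le> p"
  shows "(\<exists>C>0. \<forall>t>0. \<forall>f\<in>Lp_space \<mu> p.
            besov_seminorm \<mu> pt p ((1 - 2 / p) * (\<kappa> / d\<^sub>W) + 1 / p) (P t f)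
              \<le> ennreal (C / t powr ((1 - 2 / p) * (\<kappa> / d\<^sub>W) + 1 / p) * Lp_norm \<mu> p f)) \<and>
         (\<forall>t>0. bounded_operator \<mu>
            (Lp_space \<mu> p) (Lp_norm \<mu> p)
            (besov_space \<mu> pt p ((1 - 2 / p) * (\<kappa> / d\<^sub>W) + 1 / p))
            (besov_norm \<mu> pt p ((1 - 2 / p) * (\<kappa> / d\<^sub>W) + 1 / p)) (P t))"
proof -
  have mms: "metric_measure_space \<mu>" and P: "L2_semigroup_of_form \<mu> E F P" and ext: "extended_to_Lp \<mu> P"
    and reg: "Ahlfors_regular \<mu> d\<^sub>H" and hk: "heat_kernel \<mu> P pt" and sG: "sub_Gaussian \<mu> pt d\<^sub>H d\<^sub>W"
    and BE: "weak_Bakry_Emery \<mu> P d\<^sub>W \<kappa>" and \<kappa>: "0 < \<kappa>" and p: "2 \<le> p"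
    by fact+
  have sf: "sigma_finite_measure \<mu>"
    using reg mms by (auto intro: sigma_finite_Ahlfors_regular simp: metric_measure_space_def)
  interpret pair_sigma_finite \<mu> \<mu>
    using sf by (simp add: pair_sigma_finite_def)
  define \<alpha> where "\<alpha> = (1 - 2 / p) * (\<kappa> / d\<^sub>W) + 1 / p"
  \<comment> \<open>The exponent of \<open>s / t\<close> in the difference estimate is
    \<open>\<alpha> * p\<close>, so its p-th root has exactly the exponent of the seminorm.\<close>
  have \<alpha>: "(p - 2) * \<kappa> / d\<^sub>W + 1 = \<alpha> * p"
    using p by (simp add: \<alpha>_def distrib_right left_diff_distrib)
  have Lp: "P t f \<in> Lp_space \<mu> p" "Lp_norm \<mu> p (P t f) \<le> Lp_norm \<mu> p f"
    if "0 < t" "f \<in> Lp_space \<mu> p" for t f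
    using ext p that by (auto simp: extended_to_Lp_def contraction_operator_def)
  have lin: "linear_AE \<mu> (Lp_space \<mu> p) (P t)" if "0 < t" for t
    using ext p that by (auto simp: extended_to_Lp_def contraction_operator_def)
  have norm_nonneg: "0 \<le> Lp_norm \<mu> p f" for f
    by (simp add: Lp_norm_def)
  obtain K where K: "0 < K" and diff: "\<And>s t f. 0 < s \<Longrightarrow> 0 < t \<Longrightarrow> f \<in> Lp_space \<mu> p \<Longrightarrow>
      (\<integral>\<^sup>+(x, y). ennreal (\<bar>P t f x - P t f y\<bar> powr p * pt s x y) \<partial>(\<mu> \<Otimes>\<^sub>M \<mu>))
        \<le> ennreal (K * (s / t) powr (\<alpha> * p) * (\<integral>x. \<bar>f x\<bar> powr p \<partial>\<mu>))"
    using heat_semigroup_Lp_difference[OF mms sf P ext hk sG BE \<kappa> p] unfolding \<alpha> by blast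
  define C where "C = K powr (1 / p)"
  have C: "0 < C" using K by (simp add: C_def)
  have bound: "besov_seminorm \<mu> pt p \<alpha> (P t f) \<le> ennreal (C / t powr \<alpha> * Lp_norm \<mu> p f)"
    if t: "0 < t" and f: "f \<in> Lp_space \<mu> p" for t f
    unfolding besov_seminorm_def
  proof (rule SUP_least)
    fix s :: real assume "s \<in> {0<..}"
    then have s: "0 < s" by simp
    define N where "N = (\<integral>x. \<bar>f x\<bar> powr p \<partial>\<mu>)"
    have N: "0 \<le> N" by (simp add: N_def)
    let ?I = "\<integral>\<^sup>+y. (\<integral>\<^sup>+x. ennreal (\<bar>P t f x - P t f y\<bar> powr p * pt s x y) \<partial>\<mu>) \<partial>\<mu>"
    have [measurable]: "P t f \<in> borel_measurable \<mu>"
      using Lp(1)[OF t f] by (simp add: Lp_space_def)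
    have [measurable]: "(\<lambda>(x, y). pt s x y) \<in> borel_measurable (\<mu> \<Otimes>\<^sub>M \<mu>)"
      using hk s by (simp add: heat_kernel_def)
    \<comment> \<open>The seminorm integrates over \<open>x\<close> first, the difference estimate
      lives on the product space.\<close>
    have "?I = (\<integral>\<^sup>+(x, y). ennreal (\<bar>P t f x - P t f y\<bar> powr p * pt s x y) \<partial>(\<mu> \<Otimes>\<^sub>M \<mu>))"
      by (subst nn_integral_snd[symmetric]) auto
    then have "ennreal_powr ?I (1 / p) \<le> ennreal ((K * (s / t) powr (\<alpha> * p) * N) powr (1 / p))"
      using diff[OF s t f] K N p by (intro ennreal_powr_le) (auto simp: N_def)
    also have "(K * (s / t) powr (\<alpha> * p) * N) powr (1 / p) = C * (s powr \<alpha> / t powr \<alpha>) * Lp_norm \<mu> p f"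
      using K N s t p by (simp add: powr_mult powr_powr powr_divide C_def Lp_norm_def N_def)
    finally have "ennreal (s powr (- \<alpha>)) * ennreal_powr ?I (1 / p)
        \<le> ennreal (s powr (- \<alpha>)) * ennreal (C * (s powr \<alpha> / t powr \<alpha>) * Lp_norm \<mu> p f)"
      by (rule mult_left_mono) simp
    also have "\<dots> = ennreal (s powr (- \<alpha>) * (C * (s powr \<alpha> / t powr \<alpha>) * Lp_norm \<mu> p f))"
      by (intro ennreal_mult'[symmetric]) simp
    \<comment> \<open>The powers of \<open>s\<close> cancel, so the bound is uniform in
      \<open>s\<close> and passes to the supremum.\<close>
    also have "s powr (- \<alpha>) * (C * (s powr \<alpha> / t powr \<alpha>) * Lp_norm \<mu> p f) = C / t powr \<alpha> * Lp_norm \<mu> p f"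
      using s by (simp add: powr_minus field_simps)
    finally show "ennreal (s powr (- \<alpha>)) * ennreal_powr ?I (1 / p) \<le> ennreal (C / t powr \<alpha> * Lp_norm \<mu> p f)" .
  qed
  have "bounded_operator \<mu> (Lp_space \<mu> p) (Lp_norm \<mu> p)
      (besov_space \<mu> pt p \<alpha>) (besov_norm \<mu> pt p \<alpha>) (P t)" if t: "0 < t" for t
    unfolding bounded_operator_def
  proof (intro conjI ballI exI)
    fix f assume f: "f \<in> Lp_space \<mu> p"
    have "besov_seminorm \<mu> pt p \<alpha> (P t f) < \<top>"
      using bound[OF t f] by (rule le_less_trans) simp
    then show "P t f \<in> besov_space \<mu> pt p \<alpha>"
      using Lp[OF t f] by (simp add: besov_space_def)
    have "enn2real (besov_seminorm \<mu> pt p \<alpha> (P t f)) \<le> C / t powr \<alpha> * Lp_norm \<mu> p f"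
      using bound[OF t f] C norm_nonneg by (intro enn2real_leI) auto
    \<comment> \<open>The summand 1 comes from contractivity on \<open>Lp_space \<mu> p\<close>, the
      other from the seminorm bound.\<close>
    then show "besov_norm \<mu> pt p \<alpha> (P t f) \<le> (1 + C / t powr \<alpha>) * Lp_norm \<mu> p f"
      using Lp(2)[OF t f] by (simp add: besov_norm_def distrib_right)
  qed (rule lin[OF t])
  then show ?thesis
    using C bound unfolding \<alpha>_def by blast
qed

end
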